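(* Let $N\ge 1$ and let an $N$-generator Diffusion algebra with generators $D_1,\dots,D_N$ and coefficients $(g_{\alpha\beta},x_\alpha)$ be given (see context, also for $I$, $R$, $R_a$, $S$, $T$, $T_a^\circ$, $T_b^\bullet$ and normal ordering $:\ :$). Then it belongs to one of the following five families; that is, its defining relations are exactly those listed below in one of the cases 1–5, for suitable values of the parameters. In all cases the relations displayed are complemented by the relations among the generators indexed by $R$, namely $:D_{r_1}D_{r_2}:\;=0$ for $r_1\in R_a$, $r_2\in R_b$, $a\ne b$, and $D_{r_1}D_{r_2}-q_{r_2r_1}D_{r_2}D_{r_1}=0$ with $q_{r_2r_1}=g_{r_2r_1}/g_{r_1r_2}$ for $r_1<r_2$ in the same $R_a$ (each $R_a$ being connected in the sense of the context). 1. Type $A_I(I,S,T^\circ_a,T^\bullet_b)$, $|I|\ge 3$: $$\begin{aligned} g\,(D_iD_j-D_jD_i)&=x_jD_i-x_iD_j &&\forall i,j\in I,\\ g_s\,(D_sD_i-D_iD_s)&=x_iD_s &&\forall s\in S,\ i\in I,\\ g_a^\circ :D_iD_t:&=-x_iD_t &&\forall a,\ t\in T_a^\circ,\ i\in I,\\ g_b^+D_iD_t&=-x_iD_t &&\forall b,\ t\in T_b^\bullet,\ i\in I,\ i<t,\\ g_b^-D_tD_i&=x_iD_t &&\forall b,\ t\in T_b^\bullet,\ i\in I,\ i>t, \end{aligned}$$ where $g,g_s,g_a^\circ,g_b^\pm$ are nonzero. 2. Type $A_{II}(I,T^\circ_a,T^\bullet_b)$, $|I|\ge3$, $S=\emptyset$: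 $$\begin{aligned} (g_i-g_j)D_iD_j&=x_jD_i-x_iD_j &&\forall i<j\in I,\\ (g_i+g_a^\circ):D_iD_t:&=-x_iD_t &&\forall a,\ t\in T_a^\circ,\ i\in I,\\ (g_i+g_b^+)D_iD_t&=-x_iD_t &&\forall b,\ t\in T_b^\bullet,\ i\in I,\ i<t,\\ (g_b^--g_i)D_tD_i&=x_iD_t &&\forall b,\ t\in T_b^\bullet,\ i\in I,\ i>t, \end{aligned}$$ where $g_i\ne g_j$ for $i\neq j$, $g_i\neq -g_a^\circ$ for all $i\in I$ and all $a$, and, for every $b$ and $t\in T_b^\bullet$, $g_i\ne -g_b^+$ for all $i\in I$ with $i<t$ and $g_i\ne g_b^-$ for all $i\in I$ with $i>t$. 3. Type $B(I=\{\mathbf i,\mathbf j\},S,T^\circ_a,T^\bullet_b)$, $|I|=2$, $\mathbf i<\mathbf j$: $$\begin{aligned} gD_{\mathbf i}D_{\mathbf j}-(g-\Lambda)D_{\mathbf j}D_{\mathbf i}&=x_{\mathbf j}D_{\mathbf i}-x_{\mathbf i}D_{\mathbf j},\\ g_sD_{\mathbf i}D_s-(g_s-\Lambda)D_sD_{\mathbf i}&=-x_{\mathbf i}D_s &&\forall s\in S,\\ g_sD_sD_{\mathbf j}-(g_s-\Lambda)D_{\mathbf j}D_s&=x_{\mathbf j}D_s &&\forall s\in S,\\ g_a^\circ:D_{\mathbf i}D_t:&=-x_{\mathbf i}D_t &&\forall a,\ t\in T_a^\circ,\\ (g_a^\circ-\Lambda):D_{\mathbf j}D_t:&=-x_{\mathbf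 j}D_t &&\forall a,\ t\in T_a^\circ,\\ g_b^+D_{\mathbf i}D_t&=-x_{\mathbf i}D_t &&\forall b,\ t\in T_b^\bullet,\\ g_b^-D_tD_{\mathbf j}&=x_{\mathbf j}D_t &&\forall b,\ t\in T_b^\bullet, \end{aligned}$$ where $g\ne0$, $g_s\neq0$ for all $s\in S$, $g_s\ne\Lambda$ for all $s\in S$ with $s<\mathbf i$ or $s>\mathbf j$, $g_a^\circ\notin\{0,\Lambda\}$, $g_b^\pm\ne0$ (note $\mathbf i<t<\mathbf j$ for $t\in T_b^\bullet$). 4. Type $C(I=\{\mathbf i\},R_a)$, $|I|=1$: $$g_rD_{\mathbf i}D_r-(g_r-\Lambda_a)D_rD_{\mathbf i}=-x_{\mathbf i}D_r\qquad\forall a,\ r\in R_a,$$ where $g_r\ne0$ for $r>\mathbf i$ and $g_r\neq\Lambda_a$ for $r<\mathbf i$. 5. Type $D(R)$, $I=\emptyset$: $$D_rD_s-q_{sr}D_sD_r=0\qquad\forall r<s\in R.$$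
   Context: Diffusion algebras. Let $I_N=\{1,\dots,N\}$. Let $g_{\alpha\beta}\in\mathbb R$ for $\alpha\ne\beta\in I_N$, with $g_{\alpha\beta}\neq0$ whenever $\alpha<\beta$ (while $g_{\beta\alpha}$ for $\alpha<\beta$ may vanish), and let $x_\alpha\in\mathbb C$. Consider the (associative unital, complex) algebra with generators $D_\alpha$, $\alpha\in I_N$, and the relations, for all $\alpha<\beta$, $$g_{\alpha\beta}D_\alpha D_\beta-g_{\beta\alpha}D_\beta D_\alpha=x_\beta D_\alpha-x_\alpha D_\beta .$$ It is called a Diffusion algebra if it admits a linear (PBW) basis consisting of the ordered monomials $D_{\alpha_1}^{k_1}D_{\alpha_2}^{k_2}\cdots D_{\alpha_n}^{k_n}$, $k_j\in\mathbb N\cup\{0\}$, with $\alpha_1>\alpha_2>\dots>\alpha_n$ (i.e. the monomials $D_N^{k_N}\cdots D_1^{k_1}$). The coefficients $(g_{\alpha\beta},x_\alpha)$ are part of the data. Normal ordering. $:D_\alpha D_\beta:$ equals $D_\alpha D_\beta$ if $\alpha<\beta$ and $D_\beta D_\alpha$ if $\beta<\alpha$. Decomposition of the index set. $I:=\{\alpha\in I_N: x_\alpha\ne0\}$, $R:=\{\alpha\in I_N:x_\alpha=0\}$. The set $R$ is split into its non-empty pairwise disjoint connected components $R=R_1\cup\dots\cup R_{M_R}$ of the graph with vertex set $R$ in which distinct $r,s$ are joined iff $g_{rs}g_{sr}\ne0$. Thus for $r_1\in R_a,r_2\in R_b$, $a\neq b$, the relation reads $:D_{r_1}D_{r_2}:\;=0$;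 and any two $r,s\in R_a$ are joined by a sequence $r=r_1,\dots,r_n=s$ in $R_a$ with $\prod_{k=1}^{n-1}g_{r_kr_{k+1}}g_{r_{k+1}r_k}\neq0$. For $|I|\ge2$: a component $R_a$ is called an $S$-component if there are $r\in R_a$, $i\in I$ with $g_{ir}g_{ri}\neq0$, and a $T$-component otherwise. $S$ is the union of all $S$-components, $T$ the union of all $T$-components, the latter being denoted $T_a$. A $T$-component $T_a$ is denoted $T_a^\bullet$ if there are $i<j$ in $I$ with $T_a\subset\{i+1,\dots,j-1\}$ and $I\cap\{i+1,\dots,j-1\}=\emptyset$; otherwise it is denoted $T_a^\circ$. The components of the two kinds are numbered separately: $T_a^\circ$, $a=1,\dots,M_T^\circ$, and $T_b^\bullet$, $b=1,\dots,M_T^\bullet$. Any of these sets may be absent. All parameters $g,g_s,g_i,g_a^\circ,g_b^\pm,g_r,\Lambda,\Lambda_a,q_{sr}$ are real; parameters with subscript $a$ or $b$ depend only on the component, those with subscript $s$, $r$ or $i$ on the index. *)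

theory Defs
  imports Complex_Main "HOL-Library.Poly_Mapping" "HOL-Algebra.QuotRing"
begin

section \<open>The free algebra\<close>

datatype nc_word = Word (letters: "nat list")

instantiation nc_word :: monoid_add
begin

definition zero_nc_word :: nc_word where
  "0 = Word []"

definition plus_nc_word :: "nc_word \<Rightarrow> nc_word \<Rightarrow> nc_word" where
  "v + w = Word (letters v @ letters w)"

instance
  by standard (simp_all add: zero_nc_word_def plus_nc_word_def)

end

text \<open>
  Addition of words is concatenation, so the convolution product on finitely supported functions
  makes this type the free unital complex algebra on generators indexed by \<^typ>\<open>nat\<close>.
\<close>

type_synonym nc_poly = "nc_word \<Rightarrow>\<^sub>0 complex"

definition scale :: "complex \<Rightarrow> nc_poly \<Rightarrow> nc_poly" (infixr \<open>\<cdot>\<^sub>C\<close> 75) where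
  "c \<cdot>\<^sub>C p = Poly_Mapping.single 0 c * p"

abbreviation scale_real :: "real \<Rightarrow> nc_poly \<Rightarrow> nc_poly" (infixr \<open>\<cdot>\<^sub>R\<close> 75) where
  "c \<cdot>\<^sub>R p \<equiv> complex_of_real c \<cdot>\<^sub>C p"

definition D :: "nat \<Rightarrow> nc_poly" where
  "D \<alpha> = Poly_Mapping.single (Word [\<alpha>]) 1"

definition free_algebra :: "nat \<Rightarrow> nc_poly ring" where
  "free_algebra N =
    \<lparr>carrier = {p. \<forall>w \<in> Poly_Mapping.keys p. set (letters w) \<subseteq> {1..N}},
     mult = (*), one = 1, zero = 0, add = (+)\<rparr>"

lemma free_algebra_simps [simp]:
  "mult (free_algebra N) = (*)" "one (free_algebra N) = 1"
  "zero (free_algebra N) = 0" "add (free_algebra N) = (+)"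
  by (simp_all add: free_algebra_def)

lemma free_algebra_iff:
  "p \<in> carrier (free_algebra N) \<longleftrightarrow>
    (\<forall>w \<in> Poly_Mapping.keys p. set (letters w) \<subseteq> {1..N})"
  by (simp add: free_algebra_def)

lemma ring_free_algebra: "ring (free_algebra N)"
proof -
  let ?F = "carrier (free_algebra N)"
  have m: "p * q \<in> ?F" if "p \<in> ?F" "q \<in> ?F" for p q
    unfolding free_algebra_iff
  proof
    fix w assume "w \<in> Poly_Mapping.keys (p * q)"
    then obtain u v where uv: "w = u + v" "u \<in> Poly_Mapping.keys p" "v \<in> Poly_Mapping.keys q"
      using keys_mult[of p q] by blast
    have "set (letters w) = set (letters u) \<union> set (letters v)"
      unfolding uv(1) plus_nc_word_def by simp
    with uv(2,3) that show "set (letters w) \<subseteq> {1..N}"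
      unfolding free_algebra_iff by blast
  qed
  have a: "p + q \<in> ?F" if "p \<in> ?F" "q \<in> ?F" for p q
    using that Poly_Mapping.keys_add[of p q] unfolding free_algebra_iff by blast
  have z: "0 \<in> ?F" and o: "1 \<in> ?F"
    unfolding free_algebra_iff by (simp_all add: zero_nc_word_def)
  have n: "- p \<in> ?F" if "p \<in> ?F" for p
    using that unfolding free_algebra_iff by simp
  have "abelian_group (free_algebra N)"
  proof (rule abelian_groupI)
    fix p assume "p \<in> ?F"
    then show "\<exists>q \<in> ?F. q \<oplus>\<^bsub>free_algebra N\<^esub> p = \<zero>\<^bsub>free_algebra N\<^esub>"
      using n by (intro bexI[of _ "- p"]) simp_all
  qed (simp_all add: a z ac_simps)
  moreover have "monoid (free_algebra N)"
    by (rule monoidI) (simp_all add: m o mult.assoc)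
  ultimately show ?thesis
    by (rule ringI) (simp_all add: distrib_left distrib_right)
qed

text \<open>A relation \<open>l = r\<close> is represented by the element \<open>l - r\<close> of the free algebra.\<close>

abbreviation (input) relator :: "nc_poly \<Rightarrow> nc_poly \<Rightarrow> nc_poly" (infix \<open>\<doteq>\<close> 50) where
  "l \<doteq> r \<equiv> l - r"


section \<open>Diffusion algebras\<close>

definition defining_relations ::
  "nat \<Rightarrow> (nat \<Rightarrow> nat \<Rightarrow> real) \<Rightarrow> (nat \<Rightarrow> complex) \<Rightarrow> nc_poly set" where
  "defining_relations N g x =
    {g \<alpha> \<beta> \<cdot>\<^sub>R (D \<alpha> * D \<beta>) - g \<beta> \<alpha> \<cdot>\<^sub>R (D \<beta> * D \<alpha>) \<doteq> x \<beta> \<cdot>\<^sub>C D \<alpha> - x \<alpha> \<cdot>\<^sub>C D \<beta> | \<alpha> \<beta>.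
      \<alpha> \<in> {1..N} \<and> \<beta> \<in> {1..N} \<and> \<alpha> < \<beta>}"

definition relation_ideal ::
  "nat \<Rightarrow> (nat \<Rightarrow> nat \<Rightarrow> real) \<Rightarrow> (nat \<Rightarrow> complex) \<Rightarrow> nc_poly set" where
  "relation_ideal N g x = Idl\<^bsub>free_algebra N\<^esub> (defining_relations N g x)"

definition presented_algebra ::
  "nat \<Rightarrow> (nat \<Rightarrow> nat \<Rightarrow> real) \<Rightarrow> (nat \<Rightarrow> complex) \<Rightarrow> nc_poly set ring" where
  "presented_algebra N g x = free_algebra N Quot relation_ideal N g x"

text \<open>The representative \<open>D\<^sub>N\<^bsup>k\<^sub>N\<^esup> \<dots> D\<^sub>1\<^bsup>k\<^sub>1\<^esup>\<close> of an ordered monomial.\<close>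

definition ordered_monomial :: "nat \<Rightarrow> (nat \<Rightarrow>\<^sub>0 nat) \<Rightarrow> nc_poly" where
  "ordered_monomial N k =
    prod_list (map (\<lambda>\<alpha>. D \<alpha> ^ Poly_Mapping.lookup k \<alpha>) (rev [1..<Suc N]))"

text \<open>
  The classes of the ordered monomials form a linear basis of the presented algebra: each of its
  elements is a linear combination of them with uniquely determined, finitely supported
  coefficients.
\<close>

definition has_PBW_basis ::
  "nat \<Rightarrow> (nat \<Rightarrow> nat \<Rightarrow> real) \<Rightarrow> (nat \<Rightarrow> complex) \<Rightarrow> bool" where
  "has_PBW_basis N g x \<longleftrightarrow>
    (\<forall>X \<in> carrier (presented_algebra N g x).
      \<exists>!c :: (nat \<Rightarrow>\<^sub>0 nat) \<Rightarrow>\<^sub>0 complex.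
        (\<forall>k \<in> Poly_Mapping.keys c. Poly_Mapping.keys k \<subseteq> {1..N}) \<and>
        X = relation_ideal N g x +>\<^bsub>free_algebra N\<^esub>
              (\<Sum>k \<in> Poly_Mapping.keys c. Poly_Mapping.lookup c k \<cdot>\<^sub>C ordered_monomial N k))"

definition diffusion_algebra ::
  "nat \<Rightarrow> (nat \<Rightarrow> nat \<Rightarrow> real) \<Rightarrow> (nat \<Rightarrow> complex) \<Rightarrow> bool" where
  "diffusion_algebra N g x \<longleftrightarrow>
    (\<forall>\<alpha> \<in> {1..N}. \<forall>\<beta> \<in> {1..N}. \<alpha> < \<beta> \<longrightarrow> g \<alpha> \<beta> \<noteq> 0) \<and> has_PBW_basis N g x"

definition normal_ordered :: "nat \<Rightarrow> nat \<Rightarrow> nc_poly" (\<open>':DD':\<close>) where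
  ":DD: \<alpha> \<beta> = (if \<alpha> < \<beta> then D \<alpha> * D \<beta> else D \<beta> * D \<alpha>)"


section \<open>Decomposition of the index set\<close>

definition index_I :: "nat \<Rightarrow> (nat \<Rightarrow> complex) \<Rightarrow> nat set" where
  "index_I N x = {\<alpha> \<in> {1..N}. x \<alpha> \<noteq> 0}"

definition index_R :: "nat \<Rightarrow> (nat \<Rightarrow> complex) \<Rightarrow> nat set" where
  "index_R N x = {\<alpha> \<in> {1..N}. x \<alpha> = 0}"

definition edges :: "nat \<Rightarrow> (nat \<Rightarrow> nat \<Rightarrow> real) \<Rightarrow> (nat \<Rightarrow> complex) \<Rightarrow> (nat \<times> nat) set" where
  "edges N g x =
    {(r, s). r \<in> index_R N x \<and> s \<in> index_R N x \<and> r \<noteq> s \<and> g r s * g s r \<noteq> 0}"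

text \<open>The set of the connected components \<open>R\<^sub>a\<close>; below, the component itself serves as the label \<open>a\<close>.\<close>

definition R_components ::
  "nat \<Rightarrow> (nat \<Rightarrow> nat \<Rightarrow> real) \<Rightarrow> (nat \<Rightarrow> complex) \<Rightarrow> nat set set" where
  "R_components N g x = index_R N x // (edges N g x)\<^sup>*"

definition S_components ::
  "nat \<Rightarrow> (nat \<Rightarrow> nat \<Rightarrow> real) \<Rightarrow> (nat \<Rightarrow> complex) \<Rightarrow> nat set set" where
  "S_components N g x =
    {C \<in> R_components N g x. \<exists>r \<in> C. \<exists>i \<in> index_I N x. g i r * g r i \<noteq> 0}"

definition T_components ::
  "nat \<Rightarrow> (nat \<Rightarrow> nat \<Rightarrow> real) \<Rightarrow> (nat \<Rightarrow> complex) \<Rightarrow> nat set set" where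
  "T_components N g x = R_components N g x - S_components N g x"

definition index_S :: "nat \<Rightarrow> (nat \<Rightarrow> nat \<Rightarrow> real) \<Rightarrow> (nat \<Rightarrow> complex) \<Rightarrow> nat set" where
  "index_S N g x = \<Union> (S_components N g x)"

definition T_bullet ::
  "nat \<Rightarrow> (nat \<Rightarrow> nat \<Rightarrow> real) \<Rightarrow> (nat \<Rightarrow> complex) \<Rightarrow> nat set set" where
  "T_bullet N g x =
    {C \<in> T_components N g x. \<exists>i \<in> index_I N x. \<exists>j \<in> index_I N x.
       i < j \<and> C \<subseteq> {i<..<j} \<and> index_I N x \<inter> {i<..<j} = {}}"

definition T_circ ::
  "nat \<Rightarrow> (nat \<Rightarrow> nat \<Rightarrow> real) \<Rightarrow> (nat \<Rightarrow> complex) \<Rightarrow> nat set set" where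
  "T_circ N g x = T_components N g x - T_bullet N g x"


section \<open>The five families\<close>

text \<open>
  Two lists of relations agree if they consist of the same relations up to nonzero scalar factors
  and the trivial relation \<open>0 = 0\<close>. The factors are needed because relations between generators
  indexed by \<open>R\<close> are displayed after division by \<open>g\<^bsub>\<alpha>\<beta>\<^esub>\<close>, and because some displayed relations
  differ from the defining ones by a sign. In a relation involving some \<open>i \<in> I\<close>, the linear terms
  fix the factor.
\<close>

definition same_relations :: "nc_poly set \<Rightarrow> nc_poly set \<Rightarrow> bool" where
  "same_relations P Q \<longleftrightarrow>
    insert 0 {c \<cdot>\<^sub>C p | c p. c \<noteq> 0 \<and> p \<in> P} = insert 0 {c \<cdot>\<^sub>C q | c q. c \<noteq> 0 \<and> q \<in> Q}"

definition q_coeff :: "(nat \<Rightarrow> nat \<Rightarrow> real) \<Rightarrow> nat \<Rightarrow> nat \<Rightarrow> real" where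
  "q_coeff g s r = g s r / g r s"

definition R_relations ::
  "nat \<Rightarrow> (nat \<Rightarrow> nat \<Rightarrow> real) \<Rightarrow> (nat \<Rightarrow> complex) \<Rightarrow> nc_poly set" where
  "R_relations N g x =
    {:DD: r\<^sub>1 r\<^sub>2 \<doteq> 0 | r\<^sub>1 r\<^sub>2.
      \<exists>A \<in> R_components N g x. \<exists>B \<in> R_components N g x. A \<noteq> B \<and> r\<^sub>1 \<in> A \<and> r\<^sub>2 \<in> B}
  \<union> {D r\<^sub>1 * D r\<^sub>2 - q_coeff g r\<^sub>2 r\<^sub>1 \<cdot>\<^sub>R (D r\<^sub>2 * D r\<^sub>1) \<doteq> 0 | r\<^sub>1 r\<^sub>2.
      r\<^sub>1 < r\<^sub>2 \<and> (\<exists>A \<in> R_components N g x. r\<^sub>1 \<in> A \<and> r\<^sub>2 \<in> A)}"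

definition type_A_I ::
  "nat \<Rightarrow> (nat \<Rightarrow> nat \<Rightarrow> real) \<Rightarrow> (nat \<Rightarrow> complex) \<Rightarrow> bool" where
  "type_A_I N g x \<longleftrightarrow>
    (let I = index_I N x; S = index_S N g x; Tc = T_circ N g x; Tb = T_bullet N g x in
     card I \<ge> 3 \<and>
     (\<exists>(h :: real) (hs :: nat \<Rightarrow> real) (hc :: nat set \<Rightarrow> real)
        (hp :: nat set \<Rightarrow> real) (hm :: nat set \<Rightarrow> real).
       h \<noteq> 0 \<and> (\<forall>s \<in> S. hs s \<noteq> 0) \<and> (\<forall>a \<in> Tc. hc a \<noteq> 0) \<and>
       (\<forall>b \<in> Tb. hp b \<noteq> 0 \<and> hm b \<noteq> 0) \<and>
       same_relations (defining_relations N g x)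
        ({h \<cdot>\<^sub>R (D i * D j - D j * D i) \<doteq> x j \<cdot>\<^sub>C D i - x i \<cdot>\<^sub>C D j | i j. i \<in> I \<and> j \<in> I}
       \<union> {hs s \<cdot>\<^sub>R (D s * D i - D i * D s) \<doteq> x i \<cdot>\<^sub>C D s | s i. s \<in> S \<and> i \<in> I}
       \<union> {hc a \<cdot>\<^sub>R :DD: i t \<doteq> - (x i \<cdot>\<^sub>C D t) | a t i. a \<in> Tc \<and> t \<in> a \<and> i \<in> I}
       \<union> {hp b \<cdot>\<^sub>R (D i * D t) \<doteq> - (x i \<cdot>\<^sub>C D t) | b t i. b \<in> Tb \<and> t \<in> b \<and> i \<in> I \<and> i < t}
       \<union> {hm b \<cdot>\<^sub>R (D t * D i) \<doteq> x i \<cdot>\<^sub>C D t | b t i. b \<in> Tb \<and> t \<in> b \<and> i \<in> I \<and> i > t}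
       \<union> R_relations N g x)))"

definition type_A_II ::
  "nat \<Rightarrow> (nat \<Rightarrow> nat \<Rightarrow> real) \<Rightarrow> (nat \<Rightarrow> complex) \<Rightarrow> bool" where
  "type_A_II N g x \<longleftrightarrow>
    (let I = index_I N x; S = index_S N g x; Tc = T_circ N g x; Tb = T_bullet N g x in
     card I \<ge> 3 \<and> S = {} \<and>
     (\<exists>(hI :: nat \<Rightarrow> real) (hc :: nat set \<Rightarrow> real)
        (hp :: nat set \<Rightarrow> real) (hm :: nat set \<Rightarrow> real).
       (\<forall>i \<in> I. \<forall>j \<in> I. i \<noteq> j \<longrightarrow> hI i \<noteq> hI j) \<and>
       (\<forall>i \<in> I. \<forall>a \<in> Tc. hI i \<noteq> - hc a) \<and>
       (\<forall>b \<in> Tb. \<forall>t \<in> b.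
         (\<forall>i \<in> I. i < t \<longrightarrow> hI i \<noteq> - hp b) \<and> (\<forall>i \<in> I. i > t \<longrightarrow> hI i \<noteq> hm b)) \<and>
       same_relations (defining_relations N g x)
        ({(hI i - hI j) \<cdot>\<^sub>R (D i * D j) \<doteq> x j \<cdot>\<^sub>C D i - x i \<cdot>\<^sub>C D j | i j.
            i \<in> I \<and> j \<in> I \<and> i < j}
       \<union> {(hI i + hc a) \<cdot>\<^sub>R :DD: i t \<doteq> - (x i \<cdot>\<^sub>C D t) | a t i. a \<in> Tc \<and> t \<in> a \<and> i \<in> I}
       \<union> {(hI i + hp b) \<cdot>\<^sub>R (D i * D t) \<doteq> - (x i \<cdot>\<^sub>C D t) | b t i.
            b \<in> Tb \<and> t \<in> b \<and> i \<in> I \<and> i < t}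
       \<union> {(hm b - hI i) \<cdot>\<^sub>R (D t * D i) \<doteq> x i \<cdot>\<^sub>C D t | b t i.
            b \<in> Tb \<and> t \<in> b \<and> i \<in> I \<and> i > t}
       \<union> R_relations N g x)))"

definition type_B ::
  "nat \<Rightarrow> (nat \<Rightarrow> nat \<Rightarrow> real) \<Rightarrow> (nat \<Rightarrow> complex) \<Rightarrow> bool" where
  "type_B N g x \<longleftrightarrow>
    (let S = index_S N g x; Tc = T_circ N g x; Tb = T_bullet N g x in
     (\<exists>i j. i < j \<and> index_I N x = {i, j} \<and>
     (\<exists>(h :: real) (\<Lambda> :: real) (hs :: nat \<Rightarrow> real) (hc :: nat set \<Rightarrow> real)
        (hp :: nat set \<Rightarrow> real) (hm :: nat set \<Rightarrow> real).
       h \<noteq> 0 \<and> (\<forall>s \<in> S. hs s \<noteq> 0) \<and> (\<forall>s \<in> S. s < i \<or> s > j \<longrightarrow> hs s \<noteq> \<Lambda>) \<and>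
       (\<forall>a \<in> Tc. hc a \<notin> {0, \<Lambda>}) \<and> (\<forall>b \<in> Tb. hp b \<noteq> 0 \<and> hm b \<noteq> 0) \<and>
       same_relations (defining_relations N g x)
        ({h \<cdot>\<^sub>R (D i * D j) - (h - \<Lambda>) \<cdot>\<^sub>R (D j * D i) \<doteq> x j \<cdot>\<^sub>C D i - x i \<cdot>\<^sub>C D j}
       \<union> {hs s \<cdot>\<^sub>R (D i * D s) - (hs s - \<Lambda>) \<cdot>\<^sub>R (D s * D i) \<doteq> - (x i \<cdot>\<^sub>C D s) | s. s \<in> S}
       \<union> {hs s \<cdot>\<^sub>R (D s * D j) - (hs s - \<Lambda>) \<cdot>\<^sub>R (D j * D s) \<doteq> x j \<cdot>\<^sub>C D s | s. s \<in> S}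
       \<union> {hc a \<cdot>\<^sub>R :DD: i t \<doteq> - (x i \<cdot>\<^sub>C D t) | a t. a \<in> Tc \<and> t \<in> a}
       \<union> {(hc a - \<Lambda>) \<cdot>\<^sub>R :DD: j t \<doteq> - (x j \<cdot>\<^sub>C D t) | a t. a \<in> Tc \<and> t \<in> a}
       \<union> {hp b \<cdot>\<^sub>R (D i * D t) \<doteq> - (x i \<cdot>\<^sub>C D t) | b t. b \<in> Tb \<and> t \<in> b}
       \<union> {hm b \<cdot>\<^sub>R (D t * D j) \<doteq> x j \<cdot>\<^sub>C D t | b t. b \<in> Tb \<and> t \<in> b}
       \<union> R_relations N g x))))"

definition type_C ::
  "nat \<Rightarrow> (nat \<Rightarrow> nat \<Rightarrow> real) \<Rightarrow> (nat \<Rightarrow> complex) \<Rightarrow> bool" where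
  "type_C N g x \<longleftrightarrow>
    (let R = index_R N x in
     (\<exists>i. index_I N x = {i} \<and>
     (\<exists>(hr :: nat \<Rightarrow> real) (\<Lambda> :: nat set \<Rightarrow> real).
       (\<forall>r \<in> R. r > i \<longrightarrow> hr r \<noteq> 0) \<and>
       (\<forall>a \<in> R_components N g x. \<forall>r \<in> a. r < i \<longrightarrow> hr r \<noteq> \<Lambda> a) \<and>
       same_relations (defining_relations N g x)
        ({hr r \<cdot>\<^sub>R (D i * D r) - (hr r - \<Lambda> a) \<cdot>\<^sub>R (D r * D i) \<doteq> - (x i \<cdot>\<^sub>C D r) | a r.
            a \<in> R_components N g x \<and> r \<in> a}
       \<union> R_relations N g x))))"

definition type_D ::
  "nat \<Rightarrow> (nat \<Rightarrow> nat \<Rightarrow> real) \<Rightarrow> (nat \<Rightarrow> complex) \<Rightarrow> bool" where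
  "type_D N g x \<longleftrightarrow>
    (let R = index_R N x in
     index_I N x = {} \<and>
     same_relations (defining_relations N g x)
      ({D r * D s - q_coeff g s r \<cdot>\<^sub>R (D s * D r) \<doteq> 0 | r s. r \<in> R \<and> s \<in> R \<and> r < s}
     \<union> R_relations N g x))"

end

theory Submission
  imports Defs
begin

text \<open>
  Reducing \<open>D\<^sub>\<alpha> D\<^sub>\<beta> D\<^sub>\<gamma>\<close>, \<open>\<alpha> < \<beta> < \<gamma>\<close>, to ordered monomials in two ways, the coefficients of the
  six ordered monomials of degree at most two have to agree because of the PBW property. This gives
  two kinds of equations for \<open>\<lambda>\<^sub>i\<^sub>m = g\<^sub>i\<^sub>m - g\<^sub>m\<^sub>i\<close>: if \<open>x\<^sub>i \<noteq> 0\<close> and \<open>g\<^sub>r\<^sub>s g\<^sub>s\<^sub>r \<noteq> 0\<close>, then \<open>\<lambda>\<^sub>i\<^sub>r = \<lambda>\<^sub>i\<^sub>s\<close>; and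
  if \<open>x\<^sub>i x\<^sub>j \<noteq> 0\<close>, then \<open>g\<^sub>i\<^sub>m\<close>, \<open>g\<^sub>m\<^sub>i\<close>, \<open>g\<^sub>j\<^sub>m\<close>, \<open>g\<^sub>m\<^sub>j\<close> satisfy a linear equation depending on the position of
  \<open>m\<close> relative to \<open>i\<close> and \<open>j\<close>. Hence \<open>\<lambda>\<^sub>i\<close> is constant on the components of \<open>R\<close>, and in all cases with
  \<open>|I| \<ge> 2\<close> there is a potential \<open>h\<close> with \<open>\<lambda>\<^sub>i\<^sub>j = h\<^sub>i - h\<^sub>j\<close> on \<open>I\<close>. On a \<open>T\<close>-component \<open>\<lambda>\<^sub>i - h\<^sub>i\<close> does not
  depend on \<open>i\<close> as long as \<open>i\<close> stays on one side of it; two neighbouring indices in \<open>I\<close> are compared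
  at an element of the component that does not lie between them, which is impossible precisely
  for the components \<open>T\<^sup>\<bullet>\<close>.
\<close>

section \<open>The overlap relations\<close>

lemma scale_add_right: "c \<cdot>\<^sub>C (p + q) = c \<cdot>\<^sub>C p + c \<cdot>\<^sub>C q"
  by (simp add: scale_def distrib_left)

lemma scale_diff_right: "c \<cdot>\<^sub>C (p - q) = c \<cdot>\<^sub>C p - c \<cdot>\<^sub>C q"
  by (simp add: scale_def right_diff_distrib)

lemma scale_add_left: "(c + d) \<cdot>\<^sub>C p = c \<cdot>\<^sub>C p + d \<cdot>\<^sub>C p"
  by (simp add: scale_def distrib_right single_add)

lemma scale_diff_left: "(c - d) \<cdot>\<^sub>C p = c \<cdot>\<^sub>C p - d \<cdot>\<^sub>C p"
  by (simp add: scale_def left_diff_distrib single_diff)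

lemma scale_uminus_left: "(- c) \<cdot>\<^sub>C p = - (c \<cdot>\<^sub>C p)"
  by (simp add: scale_def single_uminus)

lemma scale_uminus_right: "c \<cdot>\<^sub>C (- p) = - (c \<cdot>\<^sub>C p)"
  by (simp add: scale_def)

lemma scale_scale: "c \<cdot>\<^sub>C d \<cdot>\<^sub>C p = (c * d) \<cdot>\<^sub>C p"
  by (simp add: scale_def mult_single flip: mult.assoc)

lemma scale_zero_left [simp]: "0 \<cdot>\<^sub>C p = 0"
  by (simp add: scale_def)

lemma scale_zero_right [simp]: "c \<cdot>\<^sub>C 0 = 0"
  by (simp add: scale_def)

lemma scale_one [simp]: "1 \<cdot>\<^sub>C p = p"
  by (simp add: scale_def)

lemma scale_mult_left: "(c \<cdot>\<^sub>C p) * q = c \<cdot>\<^sub>C (p * q)"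
  by (simp add: scale_def mult.assoc)

text \<open>A scalar sits at the empty word, the neutral element of concatenation, so it commutes
  with a generator although the product as such is not commutative.\<close>

lemma D_mult_scale: "D \<alpha> * c \<cdot>\<^sub>C p = c \<cdot>\<^sub>C (D \<alpha> * p)"
proof -
  have "D \<alpha> * Poly_Mapping.single 0 c = Poly_Mapping.single 0 c * D \<alpha>"
    by (simp add: D_def mult_single)
  then show ?thesis
    by (simp add: scale_def flip: mult.assoc)
qed

lemmas scale_simps = scale_add_right scale_diff_right scale_add_left scale_diff_left
  scale_uminus_left scale_uminus_right scale_scale scale_mult_left D_mult_scale

definition relation ::
  "(nat \<Rightarrow> nat \<Rightarrow> real) \<Rightarrow> (nat \<Rightarrow> complex) \<Rightarrow> nat \<Rightarrow> nat \<Rightarrow> nc_poly" where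
  "relation g x \<alpha> \<beta> =
    g \<alpha> \<beta> \<cdot>\<^sub>R (D \<alpha> * D \<beta>) - g \<beta> \<alpha> \<cdot>\<^sub>R (D \<beta> * D \<alpha>) - (x \<beta> \<cdot>\<^sub>C D \<alpha> - x \<alpha> \<cdot>\<^sub>C D \<beta>)"

lemma relation_swap: "relation g x \<beta> \<alpha> = - relation g x \<alpha> \<beta>"
  by (simp add: relation_def)

lemma defining_relations_eq:
  "defining_relations N g x =
    {relation g x \<alpha> \<beta> | \<alpha> \<beta>. \<alpha> \<in> {1..N} \<and> \<beta> \<in> {1..N} \<and> \<alpha> < \<beta>}"
  by (simp add: defining_relations_def relation_def)

text \<open>The two ways of reducing \<open>D\<^sub>\<alpha> D\<^sub>\<beta> D\<^sub>\<gamma>\<close> to ordered monomials, multiplied by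
  \<open>g\<^bsub>\<alpha>\<beta>\<^esub> g\<^bsub>\<beta>\<gamma>\<^esub> g\<^bsub>\<alpha>\<gamma>\<^esub>\<close>; the cubic monomials cancel.\<close>

lemma overlap_identity:
  fixes a a' b b' c c' x y z :: complex and \<alpha> \<beta> \<gamma> :: nat
  defines "rAB \<equiv> a \<cdot>\<^sub>C (D \<alpha> * D \<beta>) - a' \<cdot>\<^sub>C (D \<beta> * D \<alpha>) - (y \<cdot>\<^sub>C D \<alpha> - x \<cdot>\<^sub>C D \<beta>)"
    and "rBC \<equiv> b \<cdot>\<^sub>C (D \<beta> * D \<gamma>) - b' \<cdot>\<^sub>C (D \<gamma> * D \<beta>) - (z \<cdot>\<^sub>C D \<beta> - y \<cdot>\<^sub>C D \<gamma>)"
    and "rAC \<equiv> c \<cdot>\<^sub>C (D \<alpha> * D \<gamma>) - c' \<cdot>\<^sub>C (D \<gamma> * D \<alpha>) - (z \<cdot>\<^sub>C D \<alpha> - x \<cdot>\<^sub>C D \<gamma>)"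
  shows "(a * c) \<cdot>\<^sub>C (D \<alpha> * rBC) + (a * b') \<cdot>\<^sub>C (rAC * D \<beta>) + (b' * c') \<cdot>\<^sub>C (D \<gamma> * rAB)
      + (z * (c + b')) \<cdot>\<^sub>C rAB + (- a * y) \<cdot>\<^sub>C rAC
      + (- (b * c)) \<cdot>\<^sub>C (rAB * D \<gamma>) + (- (a' * b)) \<cdot>\<^sub>C (D \<beta> * rAC)
      + (- (a' * c')) \<cdot>\<^sub>C (rBC * D \<alpha>) + (- b * y) \<cdot>\<^sub>C rAC + (x * (a' + c)) \<cdot>\<^sub>C rBC
    = (a' * z * (c' + b - b' - c)) \<cdot>\<^sub>C (D \<beta> * D \<alpha>)
      + (c' * y * (b - a' - b' + a)) \<cdot>\<^sub>C (D \<gamma> * D \<alpha>)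
      + (b' * x * (c' + a - a' - c)) \<cdot>\<^sub>C (D \<gamma> * D \<beta>)
      + (y * z * (b + a - b' - c)) \<cdot>\<^sub>C D \<alpha>
      + (x * z * (b' - a')) \<cdot>\<^sub>C D \<beta>
      + (x * y * (a' + c - b - a)) \<cdot>\<^sub>C D \<gamma>"
  unfolding assms
  by (simp add: scale_simps algebra_simps)

section \<open>The ideal of relations and its closure properties\<close>

lemma D_carrier: "\<alpha> \<in> {1..N} \<Longrightarrow> D \<alpha> \<in> carrier (free_algebra N)"
  by (simp add: free_algebra_iff D_def)

lemma const_carrier: "Poly_Mapping.single 0 c \<in> carrier (free_algebra N)"
  by (auto simp: free_algebra_iff zero_nc_word_def)

lemma carrier_mult:
  "p \<in> carrier (free_algebra N) \<Longrightarrow> q \<in> carrier (free_algebra N) \<Longrightarrow> p * q \<in> carrier (free_algebra N)"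
  using monoid.m_closed[OF ring.is_monoid[OF ring_free_algebra], of p N q] by simp

lemma carrier_add:
  "p \<in> carrier (free_algebra N) \<Longrightarrow> q \<in> carrier (free_algebra N) \<Longrightarrow> p + q \<in> carrier (free_algebra N)"
  using ring.ring_simprules(1)[OF ring_free_algebra, of p N q] by simp

lemma carrier_scale:
  "p \<in> carrier (free_algebra N) \<Longrightarrow> c \<cdot>\<^sub>C p \<in> carrier (free_algebra N)"
  by (simp add: scale_def carrier_mult const_carrier)

lemma relation_carrier:
  assumes "\<alpha> \<in> {1..N}" "\<beta> \<in> {1..N}"
  shows "relation g x \<alpha> \<beta> \<in> carrier (free_algebra N)"
proof -
  have "relation g x \<alpha> \<beta> = complex_of_real (g \<alpha> \<beta>) \<cdot>\<^sub>C (D \<alpha> * D \<beta>)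
      + (- complex_of_real (g \<beta> \<alpha>)) \<cdot>\<^sub>C (D \<beta> * D \<alpha>) + (- x \<beta>) \<cdot>\<^sub>C D \<alpha> + x \<alpha> \<cdot>\<^sub>C D \<beta>"
    by (simp add: relation_def scale_uminus_left)
  then show ?thesis
    using assms by (simp add: carrier_add carrier_scale carrier_mult D_carrier)
qed

lemma ideal_relation_ideal: "ideal (relation_ideal N g x) (free_algebra N)"
  unfolding relation_ideal_def
  by (rule ring.genideal_ideal[OF ring_free_algebra])
    (auto simp: defining_relations_eq relation_carrier)

lemma relation_in_ideal:
  assumes "\<alpha> \<in> {1..N}" "\<beta> \<in> {1..N}" "\<alpha> < \<beta>"
  shows "relation g x \<alpha> \<beta> \<in> relation_ideal N g x"
proof -
  have "defining_relations N g x \<subseteq> carrier (free_algebra N)"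
    by (auto simp: defining_relations_eq relation_carrier)
  then show ?thesis
    using ring.genideal_self[OF ring_free_algebra] assms
    unfolding relation_ideal_def defining_relations_eq by blast
qed

lemma relation_ideal_add:
  assumes "p \<in> relation_ideal N g x" "q \<in> relation_ideal N g x"
  shows "p + q \<in> relation_ideal N g x"
  using additive_subgroup.a_closed[OF ideal.axioms(1)[OF ideal_relation_ideal]] assms by fastforce

lemma relation_ideal_lmult:
  assumes "p \<in> relation_ideal N g x" "q \<in> carrier (free_algebra N)"
  shows "q * p \<in> relation_ideal N g x"
  using ideal.I_l_closed[OF ideal_relation_ideal assms] by simp

lemma relation_ideal_rmult:
  assumes "p \<in> relation_ideal N g x" "q \<in> carrier (free_algebra N)"
  shows "p * q \<in> relation_ideal N g x"
  using ideal.I_r_closed[OF ideal_relation_ideal assms] by simp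

lemma relation_ideal_scale:
  "p \<in> relation_ideal N g x \<Longrightarrow> c \<cdot>\<^sub>C p \<in> relation_ideal N g x"
  by (simp add: scale_def relation_ideal_lmult const_carrier)

section \<open>Linear combinations of ordered monomials\<close>

definition ordered_combination :: "nat \<Rightarrow> ((nat \<Rightarrow>\<^sub>0 nat) \<Rightarrow>\<^sub>0 complex) \<Rightarrow> nc_poly" where
  "ordered_combination N c =
    (\<Sum>k \<in> Poly_Mapping.keys c. Poly_Mapping.lookup c k \<cdot>\<^sub>C ordered_monomial N k)"

text \<open>Keys of \<open>c + d\<close> may disappear by cancellation. Summing over a larger finite
  set lets two combinations be added over a common index set.\<close>

lemma ordered_combination_superset:
  assumes "finite F" "Poly_Mapping.keys c \<subseteq> F"
  shows "ordered_combination N c =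
    (\<Sum>k \<in> F. Poly_Mapping.lookup c k \<cdot>\<^sub>C ordered_monomial N k)"
  unfolding ordered_combination_def
  by (rule sum.mono_neutral_left) (use assms in \<open>auto simp: in_keys_iff\<close>)

lemma ordered_combination_add:
  "ordered_combination N (c + d) = ordered_combination N c + ordered_combination N d"
proof -
  let ?F = "Poly_Mapping.keys c \<union> Poly_Mapping.keys d"
  have "Poly_Mapping.keys (c + d) \<subseteq> ?F"
    by (rule keys_add)
  then show ?thesis
    by (simp add: ordered_combination_superset[of ?F] lookup_add scale_add_left sum.distrib)
qed

lemma ordered_combination_single:
  "ordered_combination N (Poly_Mapping.single k v) = v \<cdot>\<^sub>C ordered_monomial N k"
  by (subst ordered_combination_superset[of "{k}"]) auto

text \<open>The ideal is the zero element of the quotient. It is the coset of the combination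
  \<open>c\<close> and also that of the empty combination, so the uniqueness part of the PBW
  property identifies \<open>c\<close> with \<open>0\<close>.\<close>

lemma ordered_combination_unique:
  assumes "has_PBW_basis N g x" "ordered_combination N c \<in> relation_ideal N g x"
    and "\<forall>k \<in> Poly_Mapping.keys c. Poly_Mapping.keys k \<subseteq> {1..N}"
  shows "c = 0"
proof -
  let ?J = "relation_ideal N g x"
  interpret J: ideal ?J "free_algebra N"
    by (rule ideal_relation_ideal)
  have zero: "0 \<in> ?J"
    using additive_subgroup.zero_closed[OF J.additive_subgroup_axioms] by simp
  have J0: "?J = ?J +>\<^bsub>free_algebra N\<^esub> ordered_combination N d"
    if "ordered_combination N d \<in> ?J" for d
    using J.a_rcos_const[OF that] by simp
  have "?J \<in> carrier (presented_algebra N g x)"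
  proof -
    have "?J = ?J +>\<^bsub>free_algebra N\<^esub> 0"
      using J.a_rcos_const[OF zero] by simp
    moreover have "0 \<in> carrier (free_algebra N)"
      using J.zero_closed by simp
    ultimately show ?thesis
      unfolding presented_algebra_def FactRing_def
      by (auto simp: A_RCOSETS_def')
  qed
  define P where "P c \<longleftrightarrow> (\<forall>k \<in> Poly_Mapping.keys c. Poly_Mapping.keys k \<subseteq> {1..N}) \<and>
      ?J = ?J +>\<^bsub>free_algebra N\<^esub> ordered_combination N c" for c
  have "\<exists>!c. P c"
    using assms(1) \<open>?J \<in> carrier _\<close>
    unfolding has_PBW_basis_def ordered_combination_def P_def by (rule bspec)
  moreover have "P 0"
    unfolding P_def by (intro conjI J0) (simp_all add: ordered_combination_def zero)
  moreover have "P c"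
    unfolding P_def by (intro conjI J0 assms)
  ultimately show ?thesis
    by blast
qed

section \<open>Ordered monomials of degree one and two\<close>

lemma prod_list_map_single:
  assumes "distinct xs" "a \<in> set xs"
  shows "prod_list (map (\<lambda>i. if i = a then f i else (1 :: 'a :: monoid_mult)) xs) = f a"
  using assms
proof (induction xs)
  case (Cons b xs)
  show ?case
  proof (cases "a = b")
    case True
    with Cons.prems have "map (\<lambda>i. if i = a then f i else 1) xs = map (\<lambda>_. 1) xs"
      by auto
    with True show ?thesis
      by (simp add: map_replicate_const)
  qed (use Cons in auto)
qed simp

text \<open>Since the list decreases, the factor of the larger index \<open>b\<close> comes first;
  this is the order of factors in \<open>ordered_monomial\<close>.\<close>

lemma prod_list_map_pair:
  assumes "sorted_wrt (>) xs" "distinct xs" "a \<in> set xs" "b \<in> set xs" "a < (b :: nat)"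
  shows "prod_list (map (\<lambda>i. if i = a \<or> i = b then f i else (1 :: 'a :: monoid_mult)) xs) = f b * f a"
  using assms
proof (induction xs)
  case (Cons c xs)
  show ?case
  proof (cases "c = b")
    case True
    with Cons.prems have "map (\<lambda>i. if i = a \<or> i = b then f i else 1) xs
        = map (\<lambda>i. if i = a then f i else 1) xs"
      by auto
    moreover have "distinct xs" "a \<in> set xs"
      using Cons.prems True by auto
    ultimately have "prod_list (map (\<lambda>i. if i = a \<or> i = b then f i else 1) xs) = f a"
      by (simp only: prod_list_map_single)
    with True show ?thesis
      by simp
  next
    case False
    with Cons.prems have "a \<noteq> c"
      by auto
    with False Cons show ?thesis
      by auto
  qed
qed simp

lemma sorted_wrt_rev_upt: "sorted_wrt (>) (rev [m..<n])"
  by (simp add: sorted_wrt_rev)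

lemma ordered_monomial_single:
  assumes "\<alpha> \<in> {1..N}"
  shows "ordered_monomial N (Poly_Mapping.single \<alpha> 1) = D \<alpha>"
proof -
  have "ordered_monomial N (Poly_Mapping.single \<alpha> 1)
      = prod_list (map (\<lambda>i. if i = \<alpha> then D i else 1) (rev [1..<Suc N]))"
    unfolding ordered_monomial_def
    by (rule arg_cong[of _ _ prod_list], rule map_cong) (auto simp: lookup_single when_def)
  then show ?thesis
    using prod_list_map_single[of "rev [1..<Suc N]" \<alpha> D] assms
    by (simp del: upt_Suc)
qed

lemma ordered_monomial_pair:
  assumes "\<alpha> \<in> {1..N}" "\<beta> \<in> {1..N}" "\<alpha> < \<beta>"
  shows "ordered_monomial N (Poly_Mapping.single \<alpha> 1 + Poly_Mapping.single \<beta> 1) = D \<beta> * D \<alpha>"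
proof -
  have "ordered_monomial N (Poly_Mapping.single \<alpha> 1 + Poly_Mapping.single \<beta> 1)
      = prod_list (map (\<lambda>i. if i = \<alpha> \<or> i = \<beta> then D i else 1) (rev [1..<Suc N]))"
    unfolding ordered_monomial_def
    by (rule arg_cong[of _ _ prod_list], rule map_cong)
      (use assms in \<open>auto simp: lookup_single lookup_add when_def\<close>)
  then show ?thesis
    using prod_list_map_pair[OF sorted_wrt_rev_upt, of 1 "Suc N" \<alpha> \<beta> D] assms
    by (simp del: upt_Suc)
qed

text \<open>Natural exponents cannot cancel, so this holds for \<open>i = j\<close> as well. It lets
  the exponents of degree at most two be distinguished by their supports.\<close>

lemma keys_single_pair:
  "Poly_Mapping.keys (Poly_Mapping.single i (1 :: nat) + Poly_Mapping.single j 1) = {i, j}"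
  by (auto simp: in_keys_iff lookup_add lookup_single when_def split: if_splits)

lemma single_pair_eq_iff:
  "Poly_Mapping.single i (1 :: nat) + Poly_Mapping.single j 1
      = Poly_Mapping.single k 1 + Poly_Mapping.single l 1
    \<longleftrightarrow> (i = k \<and> j = l) \<or> (i = l \<and> j = k)" (is "?p = ?q \<longleftrightarrow> _")
proof
  assume "?p = ?q"
  then have "{i, j} = {k, l}"
    by (simp only: flip: keys_single_pair)
  then show "(i = k \<and> j = l) \<or> (i = l \<and> j = k)"
    by (simp add: doubleton_eq_iff)
next
  assume "(i = k \<and> j = l) \<or> (i = l \<and> j = k)"
  then show "?p = ?q"
    by (elim disjE conjE) (simp_all only: add.commute)
qed

lemma single_pair_neq_single:
  assumes "i \<noteq> j"
  shows "Poly_Mapping.single i (1 :: nat) + Poly_Mapping.single j 1 \<noteq> Poly_Mapping.single k 1"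
    (is "?p \<noteq> ?q")
proof
  assume "?p = ?q"
  then have "{i, j} = {k}"
    by (metis keys_single_pair keys_single zero_neq_one)
  with assms show False
    by auto
qed

lemma single_eq_iff: "Poly_Mapping.single i (1 :: nat) = Poly_Mapping.single j 1 \<longleftrightarrow> i = j"
  by (metis keys_single singleton_inject zero_neq_one)

lemma single_1_neq_0: "Poly_Mapping.single i (1 :: nat) \<noteq> 0"
  by (metis keys_single keys_zero insert_not_empty zero_neq_one)

text \<open>The right-hand side of \<open>overlap_identity\<close> is a combination of six distinct
  ordered monomials lying in the ideal, so each of its coefficients vanishes. The alternatives list
  the factors of these coefficients.\<close>

lemma overlap_conditions:
  assumes PBW: "has_PBW_basis N g x"
    and range: "\<alpha> \<in> {1..N}" "\<beta> \<in> {1..N}" "\<gamma> \<in> {1..N}" and less: "\<alpha> < \<beta>" "\<beta> < \<gamma>"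
  shows "x \<gamma> = 0 \<or> g \<beta> \<alpha> = 0 \<or> g \<gamma> \<alpha> + g \<beta> \<gamma> - g \<gamma> \<beta> - g \<alpha> \<gamma> = 0" (is ?c1)
    and "x \<beta> = 0 \<or> g \<gamma> \<alpha> = 0 \<or> g \<beta> \<gamma> - g \<beta> \<alpha> - g \<gamma> \<beta> + g \<alpha> \<beta> = 0" (is ?c2)
    and "x \<alpha> = 0 \<or> g \<gamma> \<beta> = 0 \<or> g \<gamma> \<alpha> + g \<alpha> \<beta> - g \<beta> \<alpha> - g \<alpha> \<gamma> = 0" (is ?c3)
    and "x \<beta> = 0 \<or> x \<gamma> = 0 \<or> g \<beta> \<gamma> + g \<alpha> \<beta> - g \<gamma> \<beta> - g \<alpha> \<gamma> = 0" (is ?c4)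
    and "x \<alpha> = 0 \<or> x \<gamma> = 0 \<or> g \<beta> \<alpha> = g \<gamma> \<beta>" (is ?c5)
    and "x \<alpha> = 0 \<or> x \<beta> = 0 \<or> g \<beta> \<alpha> + g \<alpha> \<gamma> - g \<beta> \<gamma> - g \<alpha> \<beta> = 0" (is ?c6)
proof -
  let ?r = complex_of_real
  let ?e = "\<lambda>i :: nat. Poly_Mapping.single i (1 :: nat)"
  \<comment> \<open>These are the six coefficients on the right-hand side of
    \<open>overlap_identity\<close>, with the real coefficients embedded into the complex
    numbers.\<close>
  define k1 where "k1 = ?r (g \<beta> \<alpha>) * x \<gamma> * (?r (g \<gamma> \<alpha>) + ?r (g \<beta> \<gamma>) - ?r (g \<gamma> \<beta>) - ?r (g \<alpha> \<gamma>))"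
  define k2 where "k2 = ?r (g \<gamma> \<alpha>) * x \<beta> * (?r (g \<beta> \<gamma>) - ?r (g \<beta> \<alpha>) - ?r (g \<gamma> \<beta>) + ?r (g \<alpha> \<beta>))"
  define k3 where "k3 = ?r (g \<gamma> \<beta>) * x \<alpha> * (?r (g \<gamma> \<alpha>) + ?r (g \<alpha> \<beta>) - ?r (g \<beta> \<alpha>) - ?r (g \<alpha> \<gamma>))"
  define k4 where "k4 = x \<beta> * x \<gamma> * (?r (g \<beta> \<gamma>) + ?r (g \<alpha> \<beta>) - ?r (g \<gamma> \<beta>) - ?r (g \<alpha> \<gamma>))"
  define k5 where "k5 = x \<alpha> * x \<gamma> * (?r (g \<gamma> \<beta>) - ?r (g \<beta> \<alpha>))"
  define k6 where "k6 = x \<alpha> * x \<beta> * (?r (g \<beta> \<alpha>) + ?r (g \<alpha> \<gamma>) - ?r (g \<beta> \<gamma>) - ?r (g \<alpha> \<beta>))"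
  define c where "c = Poly_Mapping.single (?e \<alpha> + ?e \<beta>) k1 + Poly_Mapping.single (?e \<alpha> + ?e \<gamma>) k2
    + Poly_Mapping.single (?e \<beta> + ?e \<gamma>) k3
    + Poly_Mapping.single (?e \<alpha>) k4 + Poly_Mapping.single (?e \<beta>) k5 + Poly_Mapping.single (?e \<gamma>) k6"
  let ?J = "relation_ideal N g x"
  have "ordered_combination N c = k1 \<cdot>\<^sub>C (D \<beta> * D \<alpha>) + k2 \<cdot>\<^sub>C (D \<gamma> * D \<alpha>) + k3 \<cdot>\<^sub>C (D \<gamma> * D \<beta>)
      + k4 \<cdot>\<^sub>C D \<alpha> + k5 \<cdot>\<^sub>C D \<beta> + k6 \<cdot>\<^sub>C D \<gamma>"
    using range less unfolding c_def
    by (simp add: ordered_combination_add ordered_combination_single ordered_monomial_pair ordered_monomial_single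
        del: One_nat_def)
  moreover have "relation g x \<alpha> \<beta> \<in> ?J" "relation g x \<beta> \<gamma> \<in> ?J" "relation g x \<alpha> \<gamma> \<in> ?J"
    using range less by (auto intro: relation_in_ideal)
  ultimately have "ordered_combination N c \<in> ?J"
    unfolding k1_def k2_def k3_def k4_def k5_def k6_def
    \<comment> \<open>Read from right to left, the identity expresses the combination through
      multiples of the three relations, which stay in the ideal.\<close>
    by (simp only: overlap_identity[symmetric] relation_def[symmetric])
      (intro relation_ideal_add relation_ideal_scale relation_ideal_lmult relation_ideal_rmult
        D_carrier range; assumption)
  moreover have "\<forall>k \<in> Poly_Mapping.keys c. Poly_Mapping.keys k \<subseteq> {1..N}"
  proof
    fix k assume "k \<in> Poly_Mapping.keys c"
    then have "k \<in> {?e \<alpha> + ?e \<beta>, ?e \<alpha> + ?e \<gamma>, ?e \<beta> + ?e \<gamma>, ?e \<alpha>, ?e \<beta>, ?e \<gamma>}"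
      unfolding c_def by (auto simp: in_keys_iff lookup_add lookup_single when_def split: if_splits)
    moreover have "Poly_Mapping.keys (?e i + ?e j) \<subseteq> {i, j}" for i j
      using keys_add[of "?e i" "?e j"] by auto
    ultimately show "Poly_Mapping.keys k \<subseteq> {1..N}"
      using range by fastforce
  qed
  ultimately have "c = 0"
    using ordered_combination_unique[OF PBW] by blast
  then have "Poly_Mapping.lookup c (?e \<alpha> + ?e \<beta>) = 0" "Poly_Mapping.lookup c (?e \<alpha> + ?e \<gamma>) = 0"
    "Poly_Mapping.lookup c (?e \<beta> + ?e \<gamma>) = 0" "Poly_Mapping.lookup c (?e \<alpha>) = 0"
    "Poly_Mapping.lookup c (?e \<beta>) = 0" "Poly_Mapping.lookup c (?e \<gamma>) = 0"
    by simp_all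
  then have k: "k1 = 0" "k2 = 0" "k3 = 0" "k4 = 0" "k5 = 0" "k6 = 0"
    using less
    \<comment> \<open>The six exponents are pairwise different because the three indices are, so
      each lookup picks out a single summand of \<open>c\<close>.\<close>
    by (simp_all add: c_def lookup_add lookup_single single_pair_eq_iff single_pair_neq_single
        single_pair_neq_single[symmetric] single_eq_iff single_1_neq_0 del: One_nat_def)
  show ?c1 ?c2 ?c3 ?c4 ?c5 ?c6
    using k unfolding k1_def k2_def k3_def k4_def k5_def k6_def
    by (auto simp flip: of_real_add of_real_diff)
qed


section \<open>Components of the index set\<close>

lemma sym_edges: "sym (edges N g x)"
  by (auto simp: sym_def edges_def mult.commute)

text \<open>The reflexive closure relates every natural number to itself, so the equivalence lives
  on \<open>UNIV\<close>; only the quotient in \<open>R_components\<close> restricts to classes of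
  elements of \<open>R\<close>.\<close>

lemma equiv_edges: "equiv UNIV ((edges N g x)\<^sup>*)"
  by (intro equivI) (auto intro: sym_rtrancl sym_edges trans_rtrancl refl_rtrancl)

lemma component_exists:
  assumes "r \<in> index_R N x"
  obtains C where "C \<in> R_components N g x" "r \<in> C"
  using assms by (auto simp: R_components_def quotient_def intro: that)

lemma component_subset:
  assumes "C \<in> R_components N g x"
  shows "C \<subseteq> index_R N x"
proof
  fix s assume "s \<in> C"
  with assms obtain r where r: "r \<in> index_R N x" "(r, s) \<in> (edges N g x)\<^sup>*"
    by (auto simp: R_components_def quotient_def)
  from r(2) show "s \<in> index_R N x"
    by cases (use r(1) in \<open>auto simp: edges_def\<close>)
qed

lemma component_nonempty: "C \<in> R_components N g x \<Longrightarrow> C \<noteq> {}"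
  by (auto simp: R_components_def quotient_def)

lemma component_connected:
  assumes "C \<in> R_components N g x" "r \<in> C" "s \<in> C"
  shows "(r, s) \<in> (edges N g x)\<^sup>*"
  using assms equiv_edges[of N g x] unfolding R_components_def quotient_def equiv_def
  by (auto dest: symD transD)

lemma component_edge:
  assumes "C \<in> R_components N g x" "r \<in> C" "(r, s) \<in> edges N g x"
  shows "s \<in> C"
  using assms unfolding R_components_def quotient_def by (auto intro: rtrancl_into_rtrancl)

text \<open>A path that starts at the common element \<open>r\<close> follows edges and therefore
  cannot leave either component.\<close>

lemma component_unique:
  assumes "A \<in> R_components N g x" "B \<in> R_components N g x" "r \<in> A" "r \<in> B"
  shows "A = B"
proof -
  have "s \<in> B" if "A \<in> R_components N g x" "B \<in> R_components N g x" "r \<in> A" "r \<in> B" "s \<in> A"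
    for A B s
    using component_connected[OF that(1,3,5)]
    by (induction rule: rtrancl_induct) (use that component_edge in blast)+
  with assms show ?thesis
    by blast
qed

lemma component_invariant:
  assumes "\<And>r s. (r, s) \<in> edges N g x \<Longrightarrow> f r = f s"
    and "C \<in> R_components N g x" "r \<in> C" "s \<in> C"
  shows "f r = f s"
  using component_connected[OF assms(2-)] by (induction rule: rtrancl_induct) (use assms(1) in auto)

section \<open>Equations for the coefficients of a Diffusion algebra\<close>

locale diffusion =
  fixes N :: nat and g :: "nat \<Rightarrow> nat \<Rightarrow> real" and x :: "nat \<Rightarrow> complex"
  assumes diffusion: "diffusion_algebra N g x"
begin

abbreviation "I \<equiv> index_I N x"
abbreviation "R \<equiv> index_R N x"
abbreviation "S \<equiv> index_S N g x"
abbreviation "T \<equiv> T_components N g x"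

text \<open>This is the antisymmetric quantity \<lambda> in which the overlap equations are
  expressed.\<close>

definition skew :: "nat \<Rightarrow> nat \<Rightarrow> real" where
  "skew i j = g i j - g j i"

text \<open>On distinct elements of \<open>R\<close> this is adjacency in the graph
  \<open>edges\<close>. For \<open>i < j\<close> in the index range only \<open>g j i\<close> can
  fail to be nonzero.\<close>

definition mixing :: "nat \<Rightarrow> nat \<Rightarrow> bool" where
  "mixing i j \<longleftrightarrow> g i j \<noteq> 0 \<and> g j i \<noteq> 0"

lemma mixing_commute: "mixing i j \<longleftrightarrow> mixing j i"
  by (auto simp: mixing_def)

lemma coeff_nonzero:
  "\<lbrakk>\<alpha> \<in> {1..N}; \<beta> \<in> {1..N}; \<alpha> < \<beta>\<rbrakk> \<Longrightarrow> g \<alpha> \<beta> \<noteq> 0"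
  using diffusion by (auto simp: diffusion_algebra_def)

lemma PBW: "has_PBW_basis N g x"
  using diffusion by (simp add: diffusion_algebra_def)

lemma range: "i \<in> I \<Longrightarrow> i \<in> {1..N}" "r \<in> R \<Longrightarrow> r \<in> {1..N}"
  by (auto simp: index_I_def index_R_def)

lemma x_I: "i \<in> I \<Longrightarrow> x i \<noteq> 0" and x_R: "r \<in> R \<Longrightarrow> x r = 0"
  by (auto simp: index_I_def index_R_def)

lemma I_or_R: "\<alpha> \<in> {1..N} \<Longrightarrow> \<alpha> \<in> I \<or> \<alpha> \<in> R"
  by (auto simp: index_I_def index_R_def)

lemma I_neq_R: "i \<in> I \<Longrightarrow> r \<in> R \<Longrightarrow> i \<noteq> r"
  by (auto simp: index_I_def index_R_def)

text \<open>The three overlap conditions whose factor is a quadratic monomial are one condition for the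
  three possible positions of \<open>i\<close> relative to \<open>r\<close> and \<open>s\<close>.\<close>

lemma skew_mixing:
  assumes "i \<in> I" "r \<in> {1..N}" "s \<in> {1..N}" "r \<noteq> s" "i \<noteq> r" "i \<noteq> s" "mixing r s"
  shows "skew i r = skew i s"
proof -
  have "skew i r = skew i s" if H: "r < s" "r \<in> {1..N}" "s \<in> {1..N}" "i \<noteq> r" "i \<noteq> s" "mixing r s" for r s
  proof -
    note i = range(1)[OF assms(1)] x_I[OF assms(1)]
    consider "i < r" | "r < i" "i < s" | "s < i"
      using H by linarith
    then show ?thesis
    proof cases
      case 1
      then show ?thesis
        using overlap_conditions(3)[OF PBW i(1) H(2,3) 1 H(1)] H i
        by (auto simp: skew_def mixing_def)
    next
      case 2
      then show ?thesis
        using overlap_conditions(2)[OF PBW H(2) i(1) H(3) 2] H i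
        by (auto simp: skew_def mixing_def)
    next
      case 3
      then show ?thesis
        using overlap_conditions(1)[OF PBW H(2,3) i(1) H(1) 3] H i
        by (auto simp: skew_def mixing_def)
    qed
  qed
  note sorted = this
  show ?thesis
  proof (cases "r < s")
    case True
    then show ?thesis
      using assms by (intro sorted)
  next
    case False
    then have "skew i s = skew i r"
      using assms mixing_commute by (intro sorted) auto
    then show ?thesis ..
  qed
qed

text \<open>This is the vanishing coefficient of \<open>D m\<close> when \<open>m\<close> is the
  smallest of three indices. Both sides change sign when \<open>i\<close> and \<open>j\<close> are
  exchanged, which reduces the claim to \<open>i < j\<close>.\<close>

lemma below:
  assumes "i \<in> I" "j \<in> I" "m \<in> {1..N}" "m < i" "m < j"
  shows "g m j - g m i = skew i j"
proof -
  have "g m j - g m i = skew i j" if "i \<in> I" "j \<in> I" "m < i" "i < j" for i j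
    using overlap_conditions(4)[OF PBW assms(3) range(1) range(1), of i j] that x_I
    by (auto simp: skew_def)
  from this[of i j] this[of j i] assms show ?thesis
    by (cases i j rule: linorder_cases) (auto simp: skew_def)
qed

text \<open>The counterpart of \<open>below\<close>, read off from the coefficient of the generator
  with the largest index.\<close>

lemma above:
  assumes "i \<in> I" "j \<in> I" "m \<in> {1..N}" "i < m" "j < m"
  shows "g i m - g j m = skew i j"
proof -
  have "g i m - g j m = skew i j" if "i \<in> I" "j \<in> I" "i < j" "j < m" for i j
    using overlap_conditions(6)[OF PBW range(1) range(1) assms(3), of i j] that x_I
    by (auto simp: skew_def)
  from this[of i j] this[of j i] assms show ?thesis
    by (cases i j rule: linorder_cases) (auto simp: skew_def)
qed

text \<open>Here the coefficient of the middle generator is used; it compares the two coefficients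
  that are allowed to vanish.\<close>

lemma between:
  assumes "i \<in> I" "j \<in> I" "m \<in> {1..N}" "i < m" "m < j"
  shows "g m i = g j m"
  using overlap_conditions(5)[OF PBW range(1) assms(3) range(1), of i j] assms x_I by auto

text \<open>Every edge of the component is a mixing pair in \<open>R\<close>, and \<open>i\<close>
  is neither of its ends, so \<open>skew_mixing\<close> applies along any path.\<close>

lemma skew_component:
  assumes "C \<in> R_components N g x" "r \<in> C" "s \<in> C" "i \<in> I"
  shows "skew i r = skew i s"
proof (rule component_invariant[OF _ assms(1-3)])
  fix r s assume "(r, s) \<in> edges N g x"
  then show "skew i r = skew i s"
    using assms(4) range I_neq_R by (intro skew_mixing) (auto simp: edges_def mixing_def)
qed


subsection \<open>Components that mix with \<open>I\<close>\<close>

text \<open>Seen from \<open>j\<close>, the pair \<open>i\<close>, \<open>r\<close> is mixing,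
  whence \<open>skew j i = skew j r\<close>. In each position of \<open>r\<close> the linear
  equations then equate the possibly vanishing coefficient of \<open>j\<close>, \<open>r\<close>
  with a coefficient of \<open>i\<close>, \<open>r\<close>, which is nonzero.\<close>

lemma mixing_all:
  assumes "r \<in> R" "i \<in> I" "j \<in> I" "mixing i r"
  shows "mixing j r"
proof (cases "i = j")
  case False
  have neq: "r \<noteq> i" "r \<noteq> j"
    using I_neq_R assms by blast+
  note rng = range(2)[OF assms(1)] range(1)[OF assms(2)] range(1)[OF assms(3)]
  have sk: "skew j i = skew j r"
    by (rule skew_mixing) (use assms neq rng False in auto)
  consider "r < i" "r < j" | "i < r" "j < r" | "i < r" "r < j" | "j < r" "r < i"
    using neq by linarith
  then show ?thesis
  proof cases
    case 1
    from below[OF assms(2,3) rng(1) 1] sk have "g j r = g r i"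
      by (simp add: skew_def)
    with 1 assms coeff_nonzero[OF rng(1,3)] show ?thesis
      by (simp add: mixing_def)
  next
    case 2
    from above[OF assms(2,3) rng(1) 2] sk have "g r j = g i r"
      by (simp add: skew_def)
    with 2 assms coeff_nonzero[OF rng(3,1)] show ?thesis
      by (simp add: mixing_def)
  next
    case 3
    from between[OF assms(2,3) rng(1) 3] assms coeff_nonzero[OF rng(1,3)] 3 show ?thesis
      by (simp add: mixing_def)
  next
    case 4
    from between[OF assms(3,2) rng(1) 4] assms coeff_nonzero[OF rng(3,1)] 4 show ?thesis
      by (simp add: mixing_def)
  qed
qed (use assms in simp)

lemma S_mixing:
  assumes "s \<in> S"
  obtains C r where "C \<in> R_components N g x" "s \<in> C" "r \<in> C" "\<And>i. i \<in> I \<Longrightarrow> mixing i r"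
proof -
  from assms obtain C r i where C: "C \<in> R_components N g x" "s \<in> C" "r \<in> C" "i \<in> I" "g i r * g r i \<noteq> 0"
    by (auto simp: index_S_def S_components_def)
  have "r \<in> R" "mixing i r"
    using C component_subset[OF C(1)] by (auto simp: mixing_def)
  then have "mixing j r" if "j \<in> I" for j
    using mixing_all C(4) that by blast
  then show thesis
    by (rule that[OF C(1-3)])
qed

lemma S_subset: "S \<subseteq> R"
  using component_subset by (fastforce simp: index_S_def S_components_def)

text \<open>The value is carried along the component from \<open>s\<close> to an element
  \<open>r\<close> that mixes with \<open>j\<close>, and from there to \<open>j\<close> by
  \<open>skew_mixing\<close>.\<close>

lemma S_skew:
  assumes "s \<in> S" "i \<in> I" "j \<in> I" "i \<noteq> j"
  shows "skew i s = skew i j"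
proof -
  obtain C r where C: "C \<in> R_components N g x" "s \<in> C" "r \<in> C" and mix: "\<And>i. i \<in> I \<Longrightarrow> mixing i r"
    using S_mixing[OF assms(1)] by blast
  have r: "r \<in> R"
    using C component_subset by blast
  have "skew i s = skew i r"
    by (rule skew_component[OF C assms(2)])
  also have "\<dots> = skew i j"
    using skew_mixing[OF assms(2) range(2)[OF r] range(1)[OF assms(3)]] I_neq_R[OF assms(2) r]
      I_neq_R[OF assms(3) r] assms(4) mix[OF assms(3)] mixing_commute by blast
  finally show ?thesis .
qed

text \<open>\<open>S_skew\<close> determines the differences of the coefficients at
  \<open>s\<close>; the linear equation for the position of \<open>s\<close> supplies the missing
  comparison. This is why one parameter per \<open>s\<close> suffices in the families with
  \<open>S\<close>.\<close>

lemma S_coeff: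
  assumes "s \<in> S" "i \<in> I" "j \<in> I" "i \<noteq> j"
  shows "g i s = g s j"
proof -
  have s: "s \<in> R"
    using assms S_subset by blast
  note neq = I_neq_R[OF assms(2) s] I_neq_R[OF assms(3) s]
  note sk = S_skew[OF assms] S_skew[OF assms(1,3,2) assms(4)[symmetric]]
  note rng = range(2)[OF s]
  consider "s < i" "s < j" | "i < s" "j < s" | "i < s" "s < j" | "j < s" "s < i"
    using neq by linarith
  then show ?thesis
  proof cases
    case 1
    with below[OF assms(2,3) rng 1] sk show ?thesis
      by (simp add: skew_def)
  next
    case 2
    with above[OF assms(2,3) rng 2] sk show ?thesis
      by (simp add: skew_def)
  next
    case 3
    with between[OF assms(2,3) rng 3] sk show ?thesis
      by (simp add: skew_def)
  next
    case 4
    with between[OF assms(3,2) rng 4] sk show ?thesis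
      by (simp add: skew_def)
  qed
qed


subsection \<open>Components that do not mix with \<open>I\<close>\<close>

lemma T_facts:
  assumes "C \<in> T" "t \<in> C" "i \<in> I"
  shows "C \<in> R_components N g x" "t \<in> R" "t \<in> {1..N}" "i \<in> {1..N}" "i \<noteq> t"
    and "i < t \<Longrightarrow> g t i = 0" "t < i \<Longrightarrow> g i t = 0" "skew i t \<noteq> 0"
proof -
  show C: "C \<in> R_components N g x"
    using assms by (simp add: T_components_def)
  show t: "t \<in> R"
    using component_subset[OF C] assms by blast
  show "t \<in> {1..N}" "i \<in> {1..N}" "i \<noteq> t"
    using range t assms I_neq_R by blast+
  then have nz: "i < t \<Longrightarrow> g i t \<noteq> 0" "t < i \<Longrightarrow> g t i \<noteq> 0"
    using coeff_nonzero by blast+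
  have "g i t * g t i = 0"
    using assms C unfolding T_components_def S_components_def by blast
  with nz show "i < t \<Longrightarrow> g t i = 0" "t < i \<Longrightarrow> g i t = 0"
    by auto
  with nz \<open>i \<noteq> t\<close> show "skew i t \<noteq> 0"
    by (cases i t rule: linorder_cases) (auto simp: skew_def)
qed

text \<open>As one coefficient of each pair vanishes, \<open>above\<close> and \<open>below\<close>
  become statements about \<open>skew\<close> alone.\<close>

lemma T_skew_outside:
  assumes "C \<in> T" "t \<in> C" "i \<in> I" "j \<in> I" "i < t \<and> j < t \<or> t < i \<and> t < j"
  shows "skew i t - skew j t = skew i j"
proof -
  note ti = T_facts[OF assms(1-3)] and tj = T_facts[OF assms(1,2,4)]
  from assms(5) show ?thesis
  proof
    assume "i < t \<and> j < t"
    then show ?thesis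
      using above[OF assms(3,4) ti(3)] ti(6) tj(6) by (simp add: skew_def)
  next
    assume "t < i \<and> t < j"
    then show ?thesis
      using below[OF assms(3,4) ti(3)] ti(7) tj(7) by (simp add: skew_def)
  qed
qed

text \<open>No element of \<open>I\<close> separates \<open>t\<close> from \<open>u\<close>, so both
  indices can be compared at \<open>t\<close>; invariance on the component then moves
  \<open>t\<close> to \<open>u\<close>.\<close>

lemma T_skew_same_side:
  assumes "C \<in> T" "t \<in> C" "u \<in> C" "i \<in> I" "j \<in> I" "i < t \<and> j < u \<or> t < i \<and> u < j"
    and side: "\<And>k. k \<in> I \<Longrightarrow> k < t \<longleftrightarrow> k < u"
  shows "skew i t - skew j u = skew i j"
proof -
  have "j \<noteq> t"
    using T_facts(5)[OF assms(1,2,5)] by blast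
  then have "i < t \<and> j < t \<or> t < i \<and> t < j"
    using assms(6) side[OF assms(5)] by linarith
  then have "skew i t - skew j t = skew i j"
    by (rule T_skew_outside[OF assms(1,2,4,5)])
  moreover have "skew j t = skew j u"
    using assms T_facts(1)[OF assms(1,2,4)] by (intro skew_component)
  ultimately show ?thesis
    by simp
qed

end

section \<open>Parameters of the \<open>T\<close>-components from a potential on
  \<open>I\<close>\<close>

locale diffusion_potential = diffusion +
  fixes h :: "nat \<Rightarrow> real"
  assumes potential: "i \<in> I \<Longrightarrow> j \<in> I \<Longrightarrow> skew i j = h i - h j"
begin

text \<open>Induction on the distance of \<open>i\<close> and \<open>j\<close>. If the component
  lies between them, then some element of \<open>I\<close> does too, as the component would
  otherwise be of bullet type, and the differences telescope through it. If not, \<open>i\<close>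
  and \<open>j\<close> are compared at an element outside the interval.\<close>

lemma T_circ_skew_less:
  assumes "C \<in> T_circ N g x" "t \<in> C" "i \<in> I" "j \<in> I" "i < j"
  shows "skew i t - skew j t = h i - h j"
  using assms
proof (induction "j - i" arbitrary: i j rule: less_induct)
  case less
  have C: "C \<in> T" "C \<in> R_components N g x"
    using less.prems by (auto simp: T_circ_def T_components_def)
  show ?case
  proof (cases "C \<subseteq> {i<..<j}")
    case True
    then have "I \<inter> {i<..<j} \<noteq> {}"
      using less.prems C unfolding T_circ_def T_bullet_def by blast
    then obtain k where k: "k \<in> I" "i < k" "k < j"
      by auto
    have "skew i t - skew k t = h i - h k" "skew k t - skew j t = h k - h j"
      using less.hyps[of k i] less.hyps[of j k] less.prems k by auto
    then show ?thesis
      by simp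
  next
    case False
    then obtain u where u: "u \<in> C" "u \<notin> {i<..<j}"
      by blast
    have "u \<noteq> i" "u \<noteq> j"
      using T_facts(5)[OF C(1) u(1)] less.prems by blast+
    with u less.prems have "skew i u - skew j u = skew i j"
      by (intro T_skew_outside[OF C(1)]) auto
    moreover have "skew i u = skew i t" "skew j u = skew j t"
      using less.prems u C by (auto intro: skew_component)
    ultimately show ?thesis
      using potential less.prems by simp
  qed
qed

lemma T_circ_parameter:
  assumes "C \<in> T_circ N g x"
  obtains c where "\<And>t i. t \<in> C \<Longrightarrow> i \<in> I \<Longrightarrow> skew i t = h i + c"
proof (cases "I = {}")
  case False
  then obtain j where j: "j \<in> I"
    by blast
  have C: "C \<in> R_components N g x"
    using assms by (auto simp: T_circ_def T_components_def)
  then obtain u where u: "u \<in> C"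
    using component_nonempty by blast
  \<comment> \<open>The constant is normalised at an arbitrary reference index \<open>j\<close> and
    reference element \<open>u\<close>.\<close>
  have "skew i t = h i + (skew j u - h j)" if "t \<in> C" "i \<in> I" for t i
  proof -
    have "skew i t = skew i u"
      by (rule skew_component[OF C that(1) u that(2)])
    with T_circ_skew_less[OF assms u that(2) j] T_circ_skew_less[OF assms u j that(2)] show ?thesis
      by (cases i j rule: linorder_cases) auto
  qed
  then show thesis
    by (rule that)
qed (use that in blast)

text \<open>The component fills part of a gap of \<open>I\<close> between \<open>k\<close> and
  \<open>l\<close>, so being on its left or right does not depend on the chosen element. Each side
  has its own constant, normalised at the adjacent end of the gap.\<close>

lemma T_bullet_parameters:
  assumes "C \<in> T_bullet N g x"
  obtains c d where "\<And>t i. \<lbrakk>t \<in> C; i \<in> I; i < t\<rbrakk> \<Longrightarrow> skew i t = h i + c"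
    and "\<And>t i. \<lbrakk>t \<in> C; i \<in> I; t < i\<rbrakk> \<Longrightarrow> skew i t = h i - d"
proof -
  from assms obtain k l where kl: "k \<in> I" "l \<in> I" "C \<subseteq> {k<..<l}" "I \<inter> {k<..<l} = {}"
    and C: "C \<in> T"
    by (auto simp: T_bullet_def)
  obtain u where u: "u \<in> C"
    using component_nonempty[OF T_facts(1)] C kl component_nonempty
    by (metis T_components_def DiffD1 ex_in_conv)
  have side: "i < t \<longleftrightarrow> i \<le> k" "t < i \<longleftrightarrow> l \<le> i" if "t \<in> C" "i \<in> I" for t i
  proof -
    have "\<not> (k < i \<and> i < l)" "k < t" "t < l"
      using kl that by auto
    then show "i < t \<longleftrightarrow> i \<le> k" "t < i \<longleftrightarrow> l \<le> i"
      by auto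
  qed
  have same: "skew i t - skew j u = h i - h j"
    if "t \<in> C" "i \<in> I" "j \<in> I" "i < t \<and> j < u \<or> t < i \<and> u < j" for t i j
    using T_skew_same_side[OF C that(1) u that(2-4)] side(1) u that potential by simp
  show thesis
  proof (rule that[of "skew k u - h k" "h l - skew l u"])
    fix t i assume "t \<in> C" "i \<in> I" "i < t"
    moreover have "k < u"
      using u kl by auto
    ultimately show "skew i t = h i + (skew k u - h k)"
      using same[of t i k] kl by auto
  next
    fix t i assume "t \<in> C" "i \<in> I" "t < i"
    moreover have "u < l"
      using u kl by auto
    ultimately show "skew i t = h i - (h l - skew l u)"
      using same[of t i l] kl by auto
  qed
qed

text \<open>The constants of the single components are collected into functions on the sets of
  components, with the signs used in the displayed families.\<close>

lemma T_parameters: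
  obtains hc hp hm where
    "\<And>a t i. \<lbrakk>a \<in> T_circ N g x; t \<in> a; i \<in> I\<rbrakk> \<Longrightarrow> skew i t = h i + hc a"
    "\<And>b t i. \<lbrakk>b \<in> T_bullet N g x; t \<in> b; i \<in> I; i < t\<rbrakk> \<Longrightarrow> skew i t = h i + hp b"
    "\<And>b t i. \<lbrakk>b \<in> T_bullet N g x; t \<in> b; i \<in> I; t < i\<rbrakk> \<Longrightarrow> skew i t = h i - hm b"
proof -
  have "\<exists>c. \<forall>t i. t \<in> a \<longrightarrow> i \<in> I \<longrightarrow> skew i t = h i + c" if "a \<in> T_circ N g x" for a
    by (rule T_circ_parameter[OF that]) blast
  then obtain hc where hc: "skew i t = h i + hc a" if "a \<in> T_circ N g x" "t \<in> a" "i \<in> I" for a t i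
    using bchoice[of "T_circ N g x" "\<lambda>a c. \<forall>t i. t \<in> a \<longrightarrow> i \<in> I \<longrightarrow> skew i t = h i + c"] by auto
  have "\<exists>c. \<forall>t i. t \<in> b \<longrightarrow> i \<in> I \<longrightarrow> i < t \<longrightarrow> skew i t = h i + c" if "b \<in> T_bullet N g x" for b
    by (rule T_bullet_parameters[OF that]) blast
  then obtain hp where hp: "skew i t = h i + hp b"
    if "b \<in> T_bullet N g x" "t \<in> b" "i \<in> I" "i < t" for b t i
    using bchoice[of "T_bullet N g x"
        "\<lambda>b c. \<forall>t i. t \<in> b \<longrightarrow> i \<in> I \<longrightarrow> i < t \<longrightarrow> skew i t = h i + c"] by auto
  have "\<exists>c. \<forall>t i. t \<in> b \<longrightarrow> i \<in> I \<longrightarrow> t < i \<longrightarrow> skew i t = h i - c" if "b \<in> T_bullet N g x" for b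
    by (rule T_bullet_parameters[OF that]) blast
  then obtain hm where hm: "skew i t = h i - hm b"
    if "b \<in> T_bullet N g x" "t \<in> b" "i \<in> I" "t < i" for b t i
    using bchoice[of "T_bullet N g x"
        "\<lambda>b c. \<forall>t i. t \<in> b \<longrightarrow> i \<in> I \<longrightarrow> t < i \<longrightarrow> skew i t = h i - c"] by auto
  show thesis
    by (rule that[OF hc hp hm])
qed

end

context diffusion
begin

subsection \<open>The coefficients on \<open>I\<close>\<close>

text \<open>The three linear equations leave few free coefficients. If \<open>g j i\<close>
  vanishes, so does \<open>g k j\<close>, and a nonzero \<open>g k i\<close> would force
  \<open>g i k = 0\<close>. Otherwise the quadratic conditions become available one after another
  and make all six coefficients equal.\<close>

lemma triple_sorted:
  assumes "i \<in> I" "j \<in> I" "k \<in> I" "i < j" "j < k"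
  shows "g j i = 0 \<and> g k i = 0 \<and> g k j = 0 \<or>
    g j i = g i j \<and> g i k = g i j \<and> g k i = g i j \<and> g j k = g i j \<and> g k j = g i j"
proof -
  note r = range(1)[OF assms(1)] range(1)[OF assms(2)] range(1)[OF assms(3)]
  have nz: "g i j \<noteq> 0" "g j k \<noteq> 0" "g i k \<noteq> 0"
    using coeff_nonzero r assms by auto
  have lin: "g i k - g i j = skew j k" "g j i = g k j" "g i k - g j k = skew i j"
    using below[OF assms(2,3) r(1)] between[OF assms(1,3) r(2)] above[OF assms(1,2) r(3)] assms
    by auto
  have quad: "g j i = 0 \<or> skew k i = skew k j" "g k i = 0 \<or> skew j i = skew j k"
    "g k j = 0 \<or> skew i j = skew i k"
    using skew_mixing[OF assms(3) r(1,2)] skew_mixing[OF assms(2) r(1,3)]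
      skew_mixing[OF assms(1) r(2,3)] nz assms by (auto simp: mixing_def)
  show ?thesis
  proof (cases "g j i = 0")
    case True
    with lin quad nz show ?thesis
      by (auto simp: skew_def)
  next
    case False
    with lin quad have "skew k i = skew k j" "skew i j = skew i k"
      by auto
    with lin have "g k i = g i j"
      by (simp add: skew_def)
    with quad nz have "skew j i = skew j k"
      by auto
    with \<open>skew k i = skew k j\<close> \<open>skew i j = skew i k\<close> lin \<open>g k i = g i j\<close> show ?thesis
      by (auto simp: skew_def)
  qed
qed

lemma triple_mixing:
  assumes "i \<in> I" "j \<in> I" "k \<in> I" "i \<noteq> j" "i \<noteq> k" "j \<noteq> k" "mixing i j"
  shows "g j i = g i j" "g i k = g i j" "g k i = g i j"
proof -
  consider "i < j" "j < k" | "i < k" "k < j" | "j < i" "i < k" | "j < k" "k < i" | "k < i" "i < j"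
    | "k < j" "j < i"
    using assms by linarith
  then have "g j i = g i j \<and> g i k = g i j \<and> g k i = g i j"
  proof cases
    case 1
    from triple_sorted[OF assms(1,2,3) this] assms(7) show ?thesis
      by (auto simp: mixing_def)
  next
    case 2
    from triple_sorted[OF assms(1,3,2) this] assms(7) show ?thesis
      by (auto simp: mixing_def)
  next
    case 3
    from triple_sorted[OF assms(2,1,3) this] assms(7) show ?thesis
      by (auto simp: mixing_def)
  next
    case 4
    from triple_sorted[OF assms(2,3,1) this] assms(7) show ?thesis
      by (auto simp: mixing_def)
  next
    case 5
    from triple_sorted[OF assms(3,1,2) this] assms(7) show ?thesis
      by (auto simp: mixing_def)
  next
    case 6
    from triple_sorted[OF assms(3,2,1) this] assms(7) show ?thesis
      by (auto simp: mixing_def)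
  qed
  then show "g j i = g i j" "g i k = g i j" "g k i = g i j"
    by auto
qed

text \<open>Equality of coefficients spreads from the mixing pair to all pairs containing
  \<open>a\<close>, and from these to every other pair. A third index is required already to obtain
  \<open>g b a = g a b\<close>.\<close>

lemma mixing_I:
  assumes "card I \<ge> 3" "a \<in> I" "b \<in> I" "a \<noteq> b" "mixing a b" "i \<in> I" "j \<in> I" "i \<noteq> j"
  shows "g i j = g a b"
proof -
  have "\<exists>c \<in> I. c \<noteq> a \<and> c \<noteq> b"
  proof (rule ccontr)
    assume "\<not> ?thesis"
    then have "I \<subseteq> {a, b}"
      by blast
    then have "card I \<le> card {a, b}"
      by (intro card_mono) auto
    also have "\<dots> \<le> 2"
      by (simp add: card_insert_if)
    finally show False
      using assms(1) by simp
  qed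
  then obtain c where c: "c \<in> I" "c \<noteq> a" "c \<noteq> b"
    by blast
  have a: "g a k = g a b \<and> g k a = g a b" if "k \<in> I" "k \<noteq> a" for k
    using triple_mixing[OF assms(2,3) that(1) assms(4) that(2)[symmetric] _ assms(5)]
      triple_mixing[OF assms(2,3) c(1) assms(4) c(2,3)[symmetric] assms(5)]
    by (cases "k = b") simp_all
  show ?thesis
  proof (cases "i = a \<or> j = a")
    case False
    then have ia: "g a i = g a b" "g i a = g a b"
      using a[of i] assms by auto
    then have "mixing i a"
      using assms(5) by (simp add: mixing_def)
    then have "g i j = g i a"
      using False assms triple_mixing(2)[of i a j] by auto
    with ia show ?thesis
      by simp
  next
    case True
    then show ?thesis
      using a[of i] a[of j] assms(6-8) by auto
  qed
qed

text \<open>The potential is \<open>skew i m\<close> for the least element \<open>m\<close> of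
  \<open>I\<close>. Since nothing mixes, \<open>g i m\<close> vanishes for the other
  \<open>i\<close>, and \<open>below\<close> at \<open>m\<close> gives the required
  differences.\<close>

lemma potential_exists:
  assumes "\<And>i j. i \<in> I \<Longrightarrow> j \<in> I \<Longrightarrow> i \<noteq> j \<Longrightarrow> \<not> mixing i j"
  obtains h where "diffusion_potential N g x h"
proof (cases "I = {}")
  case False
  define m where "m = Min I"
  have "finite I"
    by (simp add: index_I_def)
  with False have m: "m \<in> I" "\<And>i. i \<in> I \<Longrightarrow> m \<le> i"
    by (auto simp: m_def)
  have "skew i j = skew i m - skew j m" if ij: "i \<in> I" "j \<in> I" for i j
  proof (cases "i = m \<or> j = m")
    case True
    then show ?thesis
      by (auto simp: skew_def)
  next
    case False
    with m ij have less: "m < i" "m < j"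
      by (simp_all add: order_less_le)
    moreover have "g i m = 0" "g j m = 0"
      using assms[of m i] assms[of m j] less m ij coeff_nonzero[OF range(1) range(1)]
      by (auto simp: mixing_def)
    ultimately show ?thesis
      using below[OF ij range(1)[OF m(1)]] by (simp add: skew_def)
  qed
  then have "diffusion_potential N g x (\<lambda>i. skew i m)"
    by unfold_locales
  then show thesis
    by (rule that)
next
  case True
  then have "diffusion_potential N g x (\<lambda>i. 0)"
    by unfold_locales auto
  then show thesis
    by (rule that)
qed

end


section \<open>The five families\<close>

lemma same_relationsI:
  assumes "\<And>p. p \<in> P \<Longrightarrow> p = 0 \<or> (\<exists>c q. c \<noteq> 0 \<and> q \<in> Q \<and> p = c \<cdot>\<^sub>C q)"
    and "\<And>q. q \<in> Q \<Longrightarrow> q = 0 \<or> (\<exists>c p. c \<noteq> 0 \<and> p \<in> P \<and> q = c \<cdot>\<^sub>C p)"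
  shows "same_relations P Q"
proof -
  have "insert 0 {c \<cdot>\<^sub>C p | c p. c \<noteq> 0 \<and> p \<in> P} \<subseteq> insert 0 {c \<cdot>\<^sub>C q | c q. c \<noteq> 0 \<and> q \<in> Q}"
    if PQ: "\<And>p. p \<in> P \<Longrightarrow> p = 0 \<or> (\<exists>c q. c \<noteq> 0 \<and> q \<in> Q \<and> p = c \<cdot>\<^sub>C q)" for P Q
  proof
    fix y assume "y \<in> insert 0 {c \<cdot>\<^sub>C p | c p. c \<noteq> 0 \<and> p \<in> P}"
    then consider "y = 0" | c p where "y = c \<cdot>\<^sub>C p" "c \<noteq> 0" "p \<in> P"
      by auto
    then show "y \<in> insert 0 {c \<cdot>\<^sub>C q | c q. c \<noteq> 0 \<and> q \<in> Q}"
    proof cases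
      case (2 c p)
      from PQ[OF \<open>p \<in> P\<close>] show ?thesis
      proof (elim disjE exE conjE)
        fix d q assume "d \<noteq> 0" "q \<in> Q" "p = d \<cdot>\<^sub>C q"
        with 2 have "y = (c * d) \<cdot>\<^sub>C q" "c * d \<noteq> 0"
          by (simp_all add: scale_scale)
        with \<open>q \<in> Q\<close> show ?thesis
          by blast
      qed (use 2 in simp)
    qed simp
  qed
  from this[of P Q] this[of Q P] assms show ?thesis
    unfolding same_relations_def by (intro equalityI) simp_all
qed

context diffusion
begin

text \<open>Zero is included because the display of type \<open>A_I\<close> also ranges over
  \<open>i = j\<close>; the indices may stand in either order because the displays do.\<close>

definition relation_multiple :: "nc_poly \<Rightarrow> bool" where
  "relation_multiple q \<longleftrightarrow>
    q = 0 \<or> (\<exists>c \<alpha> \<beta>. c \<noteq> 0 \<and> \<alpha> \<in> {1..N} \<and> \<beta> \<in> {1..N} \<and> \<alpha> \<noteq> \<beta> \<and> q = c \<cdot>\<^sub>C relation g x \<alpha> \<beta>)"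

lemma relation_multiple_zero: "relation_multiple 0"
  by (simp add: relation_multiple_def)

lemma relation_multipleI:
  "\<lbrakk>\<alpha> \<in> {1..N}; \<beta> \<in> {1..N}; \<alpha> \<noteq> \<beta>; c \<noteq> 0\<rbrakk> \<Longrightarrow> relation_multiple (c \<cdot>\<^sub>C relation g x \<alpha> \<beta>)"
  unfolding relation_multiple_def by blast

lemma relation_multiple_relation:
  "\<lbrakk>\<alpha> \<in> {1..N}; \<beta> \<in> {1..N}; \<alpha> \<noteq> \<beta>\<rbrakk> \<Longrightarrow> relation_multiple (relation g x \<alpha> \<beta>)"
  using relation_multipleI[of \<alpha> \<beta> 1] by simp

lemma relation_RR:
  assumes "r \<in> R" "s \<in> R" "r < s"
  shows "relation g x r s = g r s \<cdot>\<^sub>R (D r * D s - q_coeff g s r \<cdot>\<^sub>R (D s * D r))"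
proof -
  have "g r s \<noteq> 0"
    using assms range coeff_nonzero by blast
  with assms show ?thesis
    by (simp add: relation_def x_R q_coeff_def scale_diff_right scale_scale)
qed

lemma relation_multiple_RR:
  assumes "r \<in> R" "s \<in> R" "r < s"
  shows "relation_multiple (D r * D s - q_coeff g s r \<cdot>\<^sub>R (D s * D r))"
proof -
  have "g r s \<noteq> 0"
    using assms range coeff_nonzero by blast
  then have "D r * D s - q_coeff g s r \<cdot>\<^sub>R (D s * D r) = inverse (g r s) \<cdot>\<^sub>R relation g x r s"
    by (simp add: relation_RR[OF assms] scale_scale flip: of_real_mult)
  then show ?thesis
    using assms range \<open>g r s \<noteq> 0\<close> relation_multipleI[of r s "complex_of_real (inverse (g r s))"]
    by simp
qed

lemma q_coeff_components:
  assumes "A \<in> R_components N g x" "B \<in> R_components N g x" "A \<noteq> B" "r \<in> A" "s \<in> B" "r < s"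
  shows "q_coeff g s r = 0"
proof -
  have "r \<in> R" "s \<in> R"
    using assms component_subset by blast+
  moreover have "(r, s) \<notin> edges N g x"
    using assms component_edge component_unique by metis
  ultimately have "g s r * g r s = 0"
    using assms(6) by (auto simp: edges_def)
  \<comment> \<open>Whichever factor vanishes, the quotient is zero, a zero denominator by the
    convention for division.\<close>
  then show ?thesis
    by (auto simp: q_coeff_def)
qed

lemma R_relations_multiple:
  assumes "q \<in> R_relations N g x"
  shows "relation_multiple q"
proof -
  have DD: "relation_multiple (D r * D s)"
    if "A \<in> R_components N g x" "B \<in> R_components N g x" "A \<noteq> B" "r \<in> A" "s \<in> B" "r < s" for A B r s
  proof -
    have "r \<in> R" "s \<in> R"
      using that component_subset by blast+
    with that show ?thesis
      using relation_multiple_RR[of r s] q_coeff_components[OF that] by simp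
  qed
  from assms consider
    r s A B where "q = :DD: r s" "A \<in> R_components N g x" "B \<in> R_components N g x" "A \<noteq> B"
      "r \<in> A" "s \<in> B"
    | r s A where "q = D r * D s - q_coeff g s r \<cdot>\<^sub>R (D s * D r)" "A \<in> R_components N g x"
      "r \<in> A" "s \<in> A" "r < s"
    unfolding R_relations_def by auto
  then show ?thesis
  proof cases
    case 1
    then have "r \<noteq> s"
      using component_unique by blast
    with 1 DD[of A B r s] DD[of B A s r] show ?thesis
      by (cases "r < s") (auto simp: normal_ordered_def)
  next
    case 2
    then show ?thesis
      using relation_multiple_RR component_subset by blast
  qed
qed

lemma RR_in_R_relations:
  assumes "r \<in> R" "s \<in> R" "r < s"
  shows "D r * D s - q_coeff g s r \<cdot>\<^sub>R (D s * D r) \<in> R_relations N g x"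
proof -
  obtain A B where AB: "A \<in> R_components N g x" "r \<in> A" "B \<in> R_components N g x" "s \<in> B"
    using assms component_exists by metis
  show ?thesis
  proof (cases "A = B")
    case True
    with AB assms show ?thesis
      unfolding R_relations_def diff_zero by blast
  next
    case False
    have "D r * D s - q_coeff g s r \<cdot>\<^sub>R (D s * D r) = :DD: r s - 0"
      using assms q_coeff_components[OF AB(1,3) False AB(2,4)] by (simp add: normal_ordered_def)
    with AB False show ?thesis
      unfolding R_relations_def
      by (intro UnI1 CollectI exI[of _ r] exI[of _ s] conjI bexI[of _ A] bexI[of _ B])
  qed
qed

text \<open>The relations within \<open>R\<close> are covered by \<open>R_relations\<close>, so a
  family only has to account for pairs that meet \<open>I\<close>, in either orientation when the
  partner lies in \<open>R\<close>.\<close>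

lemma same_relations_defining:
  assumes "\<And>q. q \<in> Q \<Longrightarrow> relation_multiple q"
    and II: "\<And>i j. \<lbrakk>i \<in> I; j \<in> I; i < j\<rbrakk> \<Longrightarrow> relation g x i j \<in> Q"
    and IR: "\<And>i r. \<lbrakk>i \<in> I; r \<in> R\<rbrakk> \<Longrightarrow> relation g x i r \<in> Q \<or> relation g x r i \<in> Q"
  shows "same_relations (defining_relations N g x) (Q \<union> R_relations N g x)"
proof (rule same_relationsI)
  fix p assume "p \<in> defining_relations N g x"
  then obtain \<alpha> \<beta> where p: "p = relation g x \<alpha> \<beta>" and \<alpha>\<beta>: "\<alpha> \<in> {1..N}" "\<beta> \<in> {1..N}" "\<alpha> < \<beta>"
    by (auto simp: defining_relations_eq)
  let ?P = "p = 0 \<or> (\<exists>c q. c \<noteq> 0 \<and> q \<in> Q \<union> R_relations N g x \<and> p = c \<cdot>\<^sub>C q)"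
  have scaled: ?P if "c \<noteq> 0" "q \<in> Q \<union> R_relations N g x" "p = c \<cdot>\<^sub>C q" for c q
    using that by blast
  have plus: ?P if "p \<in> Q"
    by (rule scaled[of 1 p]) (use that in auto)
  have minus: ?P if "relation g x \<beta> \<alpha> \<in> Q"
    by (rule scaled[of "- 1" "relation g x \<beta> \<alpha>"])
      (use that in \<open>simp_all add: p relation_swap[of g x \<alpha>] scale_uminus_left\<close>)
  show ?P
  proof (cases "\<alpha> \<in> I \<or> \<beta> \<in> I")
    case True
    then have "p \<in> Q \<or> relation g x \<beta> \<alpha> \<in> Q"
      using II IR I_or_R[OF \<alpha>\<beta>(1)] I_or_R[OF \<alpha>\<beta>(2)] \<alpha>\<beta> p by blast
    then show ?thesis
      using plus minus by blast
  next
    case False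
    then have R: "\<alpha> \<in> R" "\<beta> \<in> R"
      using I_or_R \<alpha>\<beta> by blast+
    show ?thesis
      by (rule scaled[OF _ UnI2[OF RR_in_R_relations[OF R \<alpha>\<beta>(3)]], of "complex_of_real (g \<alpha> \<beta>)"])
        (use coeff_nonzero[OF \<alpha>\<beta>] relation_RR[OF R \<alpha>\<beta>(3)] p in simp_all)
  qed
next
  fix q assume "q \<in> Q \<union> R_relations N g x"
  then have "relation_multiple q"
    using assms(1) R_relations_multiple by blast
  have in_defining: "q = 0 \<or> (\<exists>c p. c \<noteq> 0 \<and> p \<in> defining_relations N g x \<and> q = c \<cdot>\<^sub>C p)"
    if "c \<noteq> 0" "\<alpha> \<in> {1..N}" "\<beta> \<in> {1..N}" "\<alpha> < \<beta>" "q = c \<cdot>\<^sub>C relation g x \<alpha> \<beta>" for c \<alpha> \<beta>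
    using that unfolding defining_relations_eq by blast
  from \<open>relation_multiple q\<close> consider "q = 0" | c \<alpha> \<beta> where "c \<noteq> 0" "\<alpha> \<in> {1..N}" "\<beta> \<in> {1..N}" "\<alpha> < \<beta>"
      "q = c \<cdot>\<^sub>C relation g x \<alpha> \<beta>"
    | c \<alpha> \<beta> where "c \<noteq> 0" "\<alpha> \<in> {1..N}" "\<beta> \<in> {1..N}" "\<alpha> < \<beta>"
      "q = c \<cdot>\<^sub>C relation g x \<beta> \<alpha>"
    unfolding relation_multiple_def by (metis nat_neq_iff)
  then show "q = 0 \<or> (\<exists>c p. c \<noteq> 0 \<and> p \<in> defining_relations N g x \<and> q = c \<cdot>\<^sub>C p)"
  proof cases
    case (3 c \<alpha> \<beta>)
    then have "q = (- c) \<cdot>\<^sub>C relation g x \<alpha> \<beta>"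
      by (simp add: relation_swap[of g x \<beta>] scale_uminus_left scale_uminus_right)
    with 3 in_defining[of "- c" \<alpha> \<beta>] show ?thesis
      by simp
  qed (use in_defining in auto)
qed

lemma relation_IR:
  assumes "r \<in> R"
  shows "relation g x i r = g i r \<cdot>\<^sub>R (D i * D r) - g r i \<cdot>\<^sub>R (D r * D i) - (- (x i \<cdot>\<^sub>C D r))"
    and "relation g x r i = g r i \<cdot>\<^sub>R (D r * D i) - g i r \<cdot>\<^sub>R (D i * D r) - x i \<cdot>\<^sub>C D r"
  using assms by (simp_all add: relation_def x_R)

text \<open>By \<open>T_facts\<close> only one quadratic term survives, and its coefficient is
  \<open>skew i t\<close> up to a sign fixed by the order of \<open>i\<close> and
  \<open>t\<close>.\<close>

lemma relation_IT:
  assumes "C \<in> T" "t \<in> C" "i \<in> I"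
  shows "relation g x i t = skew i t \<cdot>\<^sub>R :DD: i t - (- (x i \<cdot>\<^sub>C D t))"
    and "i < t \<Longrightarrow> relation g x i t = skew i t \<cdot>\<^sub>R (D i * D t) - (- (x i \<cdot>\<^sub>C D t))"
    and "t < i \<Longrightarrow> relation g x t i = (- skew i t) \<cdot>\<^sub>R (D t * D i) - x i \<cdot>\<^sub>C D t"
proof -
  note T = T_facts[OF assms]
  show "i < t \<Longrightarrow> relation g x i t = skew i t \<cdot>\<^sub>R (D i * D t) - (- (x i \<cdot>\<^sub>C D t))"
    and "t < i \<Longrightarrow> relation g x t i = (- skew i t) \<cdot>\<^sub>R (D t * D i) - x i \<cdot>\<^sub>C D t"
    by (simp_all add: relation_IR[OF T(2)] T skew_def)
  show "relation g x i t = skew i t \<cdot>\<^sub>R :DD: i t - (- (x i \<cdot>\<^sub>C D t))"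
    using T(5) by (cases i t rule: linorder_cases)
      (simp_all add: relation_IR[OF T(2)] T skew_def normal_ordered_def scale_uminus_left)
qed

lemma R_cases:
  assumes "r \<in> R"
  obtains "r \<in> S" | a where "a \<in> T_circ N g x" "r \<in> a" | b where "b \<in> T_bullet N g x" "r \<in> b"
proof -
  obtain C where "C \<in> R_components N g x" "r \<in> C"
    using component_exists[OF assms] .
  then show thesis
    using that unfolding index_S_def T_circ_def T_components_def by blast
qed

lemma T_circ_T: "a \<in> T_circ N g x \<Longrightarrow> a \<in> T" and T_bullet_T: "b \<in> T_bullet N g x \<Longrightarrow> b \<in> T"
  by (auto simp: T_circ_def T_bullet_def)

lemma T_nonempty:
  assumes "C \<in> T"
  obtains t where "t \<in> C"
  using component_nonempty assms unfolding T_components_def by blast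

lemma T_bullet_sides:
  assumes "b \<in> T_bullet N g x"
  obtains t i j where "t \<in> b" "i \<in> I" "j \<in> I" "i < t" "t < j"
proof -
  obtain t where "t \<in> b"
    using T_nonempty[OF T_bullet_T[OF assms]] .
  moreover obtain i j where "i \<in> I" "j \<in> I" "b \<subseteq> {i<..<j}"
    using assms by (auto simp: T_bullet_def)
  ultimately show thesis
    by (intro that[of t i j]) auto
qed

section \<open>At most one index in \<open>I\<close>\<close>

lemma is_type_D:
  assumes "I = {}"
  shows "type_D N g x"
  unfolding type_D_def Let_def
proof (intro conjI assms same_relations_defining)
  fix q assume "q \<in> {D r * D s - q_coeff g s r \<cdot>\<^sub>R (D s * D r) \<doteq> 0 | r s. r \<in> R \<and> s \<in> R \<and> r < s}"
  then show "relation_multiple q"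
    using relation_multiple_RR by auto
qed (use assms in auto)

lemma is_type_C:
  assumes I: "I = {i}"
  shows "type_C N g x"
proof -
  have i: "i \<in> I"
    using I by simp
  have nz: "i < r \<Longrightarrow> g i r \<noteq> 0" "r < i \<Longrightarrow> g r i \<noteq> 0" if "r \<in> R" for r
    using coeff_nonzero range i that by blast+
  \<comment> \<open>The common value of \<open>skew i\<close> on a component serves as its parameter
    \<open>\<Lambda> a\<close>; the parameter of the index \<open>r\<close> is \<open>g i r\<close>
    itself.\<close>
  have "\<exists>l. \<forall>r \<in> C. skew i r = l" if "C \<in> R_components N g x" for C
    using skew_component[OF that _ _ i] component_nonempty[OF that] by blast
  then obtain l where l: "skew i r = l C" if "C \<in> R_components N g x" "r \<in> C" for C r
    by metis
  have l': "g i r - l C = g r i" if "C \<in> R_components N g x" "r \<in> C" for C r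
    using l[OF that] by (simp add: skew_def)
  have sub: "r \<in> R" if "C \<in> R_components N g x" "r \<in> C" for C r
    using component_subset that by blast
  show ?thesis
    unfolding type_C_def Let_def
  proof (intro exI[of _ i] conjI I exI[of _ "g i"] exI[of _ l] ballI impI same_relations_defining)
    fix q assume "q \<in> {g i r \<cdot>\<^sub>R (D i * D r) - (g i r - l a) \<cdot>\<^sub>R (D r * D i) \<doteq> - (x i \<cdot>\<^sub>C D r) | a r.
            a \<in> R_components N g x \<and> r \<in> a}"
    then obtain a r where a: "a \<in> R_components N g x" "r \<in> a"
      and q: "q = g i r \<cdot>\<^sub>R (D i * D r) - (g i r - l a) \<cdot>\<^sub>R (D r * D i) - (- (x i \<cdot>\<^sub>C D r))"
      by blast
    have "q = relation g x i r"
      unfolding q by (simp only: l'[OF a] relation_IR[OF sub[OF a]])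
    then show "relation_multiple q"
      using relation_multiple_relation range i sub[OF a] I_neq_R by simp
  next
    fix i' r assume "i' \<in> I" and r: "r \<in> R"
    then have [simp]: "i' = i"
      using I by simp
    obtain a where a: "a \<in> R_components N g x" "r \<in> a"
      using component_exists[OF r] .
    have "relation g x i r = g i r \<cdot>\<^sub>R (D i * D r) - (g i r - l a) \<cdot>\<^sub>R (D r * D i) - (- (x i \<cdot>\<^sub>C D r))"
      by (simp only: l'[OF a] relation_IR[OF r])
    with a show "relation g x i' r \<in> {g i r \<cdot>\<^sub>R (D i * D r) - (g i r - l a) \<cdot>\<^sub>R (D r * D i)
          \<doteq> - (x i \<cdot>\<^sub>C D r) | a r. a \<in> R_components N g x \<and> r \<in> a} \<or>
        relation g x r i' \<in> {g i r \<cdot>\<^sub>R (D i * D r) - (g i r - l a) \<cdot>\<^sub>R (D r * D i)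
          \<doteq> - (x i \<cdot>\<^sub>C D r) | a r. a \<in> R_components N g x \<and> r \<in> a}"
      by auto
  next
    fix r assume "r \<in> R" "i < r"
    then show "g i r \<noteq> 0"
      by (rule nz)
  next
    fix a r assume "a \<in> R_components N g x" "r \<in> a" "r < i"
    then show "g i r \<noteq> l a"
      using l' nz sub by fastforce
  qed (use I in auto)
qed

section \<open>Three or more indices in \<open>I\<close>\<close>

lemma relation_multiple_II:
  "\<lbrakk>i \<in> I; j \<in> I; i \<noteq> j\<rbrakk> \<Longrightarrow> relation_multiple (relation g x i j)"
  by (rule relation_multiple_relation) (rule range, assumption)+

lemma relation_multiple_IR:
  assumes "i \<in> I" "r \<in> R"
  shows "relation_multiple (relation g x i r)" "relation_multiple (relation g x r i)"
  using relation_multiple_relation range assms I_neq_R[OF assms] by blast+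

text \<open>This serves both types with three or more indices in \<open>I\<close>. The coefficients
  may depend on the component and on \<open>i\<close>, which covers constant parameters as well as
  those shifted by the potential.\<close>

lemma same_relations_T:
  assumes Q: "\<And>q. q \<in> Q \<Longrightarrow> relation_multiple q"
    and II: "\<And>i j. \<lbrakk>i \<in> I; j \<in> I; i < j\<rbrakk> \<Longrightarrow> relation g x i j \<in> Q"
    and SI: "\<And>s i. \<lbrakk>s \<in> S; i \<in> I\<rbrakk> \<Longrightarrow> relation g x s i \<in> Q"
    and c: "\<And>a t i. \<lbrakk>a \<in> T_circ N g x; t \<in> a; i \<in> I\<rbrakk> \<Longrightarrow> skew i t = c a i"
    and p: "\<And>b t i. \<lbrakk>b \<in> T_bullet N g x; t \<in> b; i \<in> I; i < t\<rbrakk> \<Longrightarrow> skew i t = p b i"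
    and m: "\<And>b t i. \<lbrakk>b \<in> T_bullet N g x; t \<in> b; i \<in> I; i > t\<rbrakk> \<Longrightarrow> skew i t = - m b i"
  shows "same_relations (defining_relations N g x)
    (Q \<union> {c a i \<cdot>\<^sub>R :DD: i t \<doteq> - (x i \<cdot>\<^sub>C D t) | a t i. a \<in> T_circ N g x \<and> t \<in> a \<and> i \<in> I}
       \<union> {p b i \<cdot>\<^sub>R (D i * D t) \<doteq> - (x i \<cdot>\<^sub>C D t) | b t i.
            b \<in> T_bullet N g x \<and> t \<in> b \<and> i \<in> I \<and> i < t}
       \<union> {m b i \<cdot>\<^sub>R (D t * D i) \<doteq> x i \<cdot>\<^sub>C D t | b t i.
            b \<in> T_bullet N g x \<and> t \<in> b \<and> i \<in> I \<and> i > t}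
       \<union> R_relations N g x)"
    (is "same_relations _ (Q \<union> ?c \<union> ?p \<union> ?m \<union> _)")
proof (rule same_relations_defining)
  have c': "relation g x i t = c a i \<cdot>\<^sub>R :DD: i t - (- (x i \<cdot>\<^sub>C D t))"
    if "a \<in> T_circ N g x" "t \<in> a" "i \<in> I" for a t i
    using relation_IT(1)[OF T_circ_T[OF that(1)] that(2,3)] c[OF that] by simp
  have p': "relation g x i t = p b i \<cdot>\<^sub>R (D i * D t) - (- (x i \<cdot>\<^sub>C D t))"
    if "b \<in> T_bullet N g x" "t \<in> b" "i \<in> I" "i < t" for b t i
    using relation_IT(2)[OF T_bullet_T[OF that(1)] that(2-4)] p[OF that] by simp
  have m': "relation g x t i = m b i \<cdot>\<^sub>R (D t * D i) - x i \<cdot>\<^sub>C D t"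
    if "b \<in> T_bullet N g x" "t \<in> b" "i \<in> I" "i > t" for b t i
    using relation_IT(3)[OF T_bullet_T[OF that(1)] that(2-4)] m[OF that] by simp
  note mult = relation_multiple_IR[OF _ T_facts(2)]
  show "relation_multiple q" if "q \<in> Q \<union> ?c \<union> ?p \<union> ?m" for q
    using that
  proof (elim UnE CollectE exE conjE)
    fix a t i
    assume H: "q = c a i \<cdot>\<^sub>R :DD: i t - (- (x i \<cdot>\<^sub>C D t))" "a \<in> T_circ N g x" "t \<in> a" "i \<in> I"
    show ?thesis
      using mult(1)[OF H(4) T_circ_T[OF H(2)] H(3,4)] unfolding c'[OF H(2-4)] H(1) .
  next
    fix b t i
    assume H: "q = p b i \<cdot>\<^sub>R (D i * D t) - (- (x i \<cdot>\<^sub>C D t))"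
      "b \<in> T_bullet N g x" "t \<in> b" "i \<in> I" "i < t"
    show ?thesis
      using mult(1)[OF H(4) T_bullet_T[OF H(2)] H(3,4)] unfolding p'[OF H(2-5)] H(1) .
  next
    fix b t i
    assume H: "q = m b i \<cdot>\<^sub>R (D t * D i) - x i \<cdot>\<^sub>C D t"
      "b \<in> T_bullet N g x" "t \<in> b" "i \<in> I" "i > t"
    show ?thesis
      using mult(2)[OF H(4) T_bullet_T[OF H(2)] H(3,4)] unfolding m'[OF H(2-5)] H(1) .
  qed (rule Q)
  show "relation g x i j \<in> Q \<union> ?c \<union> ?p \<union> ?m" if "i \<in> I" "j \<in> I" "i < j" for i j
    using II[OF that] by (intro UnI1)
  show "relation g x i r \<in> Q \<union> ?c \<union> ?p \<union> ?m \<or> relation g x r i \<in> Q \<union> ?c \<union> ?p \<union> ?m"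
    if i: "i \<in> I" and r: "r \<in> R" for i r
    using r
  proof (cases rule: R_cases)
    case 1
    then have "relation g x r i \<in> Q"
      using SI i by blast
    then show ?thesis
      by simp
  next
    case (2 a)
    have "relation g x i r \<in> ?c"
      using c'[OF 2 i] 2 i by blast
    then show ?thesis
      by simp
  next
    case (3 b)
    show ?thesis
    proof (cases "i < r")
      case True
      have "relation g x i r \<in> ?p"
        using p'[OF 3 i True] 3 i True by blast
      then show ?thesis
        by simp
    next
      case False
      then have "r < i"
        using I_neq_R[OF i r] by simp
      then have "relation g x r i \<in> ?m"
        using m'[OF 3 i] 3 i by blast
      then show ?thesis
        by simp
    qed
  qed
qed

text \<open>An element of \<open>S\<close> would give \<open>skew i j = skew i k\<close> for three
  distinct indices. The potential turns this into \<open>skew j k = 0\<close>, which is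
  excluded.\<close>

lemma S_empty:
  assumes "card I \<ge> 3" "\<And>i j. i \<in> I \<Longrightarrow> j \<in> I \<Longrightarrow> i \<noteq> j \<Longrightarrow> skew i j \<noteq> 0"
    and pot: "diffusion_potential N g x h"
  shows "S = {}"
proof (rule ccontr)
  assume "S \<noteq> {}"
  then obtain s where s: "s \<in> S"
    by blast
  obtain K where "K \<subseteq> I" "card K = 3"
    using obtain_subset_with_card_n[OF assms(1)] by blast
  then obtain i j k where ijk: "i \<in> I" "j \<in> I" "k \<in> I" "i \<noteq> j" "i \<noteq> k" "j \<noteq> k"
    by (auto simp: card_3_iff)
  interpret diffusion_potential N g x h
    by (rule pot)
  have "skew i j = skew i k"
    using S_skew[OF s] ijk by metis
  with potential ijk have "skew j k = 0"
    by simp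
  with assms(2) ijk show False
    by blast
qed

lemma is_type_A_I:
  assumes "card I \<ge> 3" "a \<in> I" "b \<in> I" "a \<noteq> b" "mixing a b"
  shows "type_A_I N g x"
proof -
  define h where "h = g a b"
  have h: "g i j = h" if "i \<in> I" "j \<in> I" "i \<noteq> j" for i j
    unfolding h_def by (rule mixing_I) (use assms that in auto)
  have skew_I: "skew i j = 0" if "i \<in> I" "j \<in> I" for i j
    using h that by (cases "i = j") (auto simp: skew_def)
  \<comment> \<open>All coefficients on \<open>I\<close> coincide, so \<open>skew\<close> vanishes
    there and the zero potential is available.\<close>
  interpret diffusion_potential N g x "\<lambda>_. 0"
    by unfold_locales (simp add: skew_I)
  obtain hc hp hm where
    "\<And>a t i. \<lbrakk>a \<in> T_circ N g x; t \<in> a; i \<in> I\<rbrakk> \<Longrightarrow> skew i t = 0 + hc a"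
    "\<And>b t i. \<lbrakk>b \<in> T_bullet N g x; t \<in> b; i \<in> I; i < t\<rbrakk> \<Longrightarrow> skew i t = 0 + hp b"
    "\<And>b t i. \<lbrakk>b \<in> T_bullet N g x; t \<in> b; i \<in> I; t < i\<rbrakk> \<Longrightarrow> skew i t = 0 - hm b"
    using T_parameters by blast
  note hc = this(1)[unfolded add_0] and hp = this(2)[unfolded add_0] and hm = this(3)[unfolded diff_0]
  define hs where "hs s = g a s" for s
  have other: "\<exists>j \<in> I. i \<noteq> j" for i
    using assms(2-4) by metis
  \<comment> \<open>By \<open>S_skew\<close> the difference of the two coefficients is a value of
    \<open>skew\<close> on \<open>I\<close>, hence zero.\<close>
  have sym: "g i s = g s i" if "s \<in> S" "i \<in> I" for s i
    using other[of i] S_skew[OF that] skew_I that by (auto simp: skew_def)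
  have hs: "g i s = hs s" "g s i = hs s" if "s \<in> S" "i \<in> I" for s i
  proof -
    show "g i s = hs s"
      using S_coeff[OF that(1) assms(2) that(2)] sym[OF that] unfolding hs_def by metis
    with sym[OF that] show "g s i = hs s"
      by simp
  qed
  have SR: "s \<in> R" "s \<in> {1..N}" if "s \<in> S" for s
    using that S_subset range by blast+
  let ?Q1 = "{h \<cdot>\<^sub>R (D i * D j - D j * D i) \<doteq> x j \<cdot>\<^sub>C D i - x i \<cdot>\<^sub>C D j | i j. i \<in> I \<and> j \<in> I}"
  let ?Q2 = "{hs s \<cdot>\<^sub>R (D s * D i - D i * D s) \<doteq> x i \<cdot>\<^sub>C D s | s i. s \<in> S \<and> i \<in> I}"
  have Q1: "relation g x i j = h \<cdot>\<^sub>R (D i * D j - D j * D i) - (x j \<cdot>\<^sub>C D i - x i \<cdot>\<^sub>C D j)"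
    if "i \<in> I" "j \<in> I" "i \<noteq> j" for i j
    using h that by (simp add: relation_def scale_diff_right)
  have Q2: "relation g x s i = hs s \<cdot>\<^sub>R (D s * D i - D i * D s) - x i \<cdot>\<^sub>C D s"
    if "s \<in> S" "i \<in> I" for s i
    using hs[OF that] by (simp add: relation_IR[OF SR(1)[OF that(1)]] scale_diff_right)
  have "same_relations (defining_relations N g x) (?Q1 \<union> ?Q2
      \<union> {hc a \<cdot>\<^sub>R :DD: i t \<doteq> - (x i \<cdot>\<^sub>C D t) | a t i. a \<in> T_circ N g x \<and> t \<in> a \<and> i \<in> I}
      \<union> {hp b \<cdot>\<^sub>R (D i * D t) \<doteq> - (x i \<cdot>\<^sub>C D t) | b t i.
          b \<in> T_bullet N g x \<and> t \<in> b \<and> i \<in> I \<and> i < t}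
      \<union> {hm b \<cdot>\<^sub>R (D t * D i) \<doteq> x i \<cdot>\<^sub>C D t | b t i.
          b \<in> T_bullet N g x \<and> t \<in> b \<and> i \<in> I \<and> i > t}
      \<union> R_relations N g x)"
  proof (rule same_relations_T)
    fix q assume "q \<in> ?Q1 \<union> ?Q2"
    then show "relation_multiple q"
    proof (elim UnE CollectE exE conjE)
      fix i j assume H: "q = h \<cdot>\<^sub>R (D i * D j - D j * D i) - (x j \<cdot>\<^sub>C D i - x i \<cdot>\<^sub>C D j)"
        "i \<in> I" "j \<in> I"
      then show ?thesis
      proof (cases "i = j")
        case False
        show ?thesis
          using relation_multiple_II[OF H(2,3) False] unfolding Q1[OF H(2,3) False] H(1) .
      qed (simp add: relation_multiple_zero)
    next
      fix s i assume H: "q = hs s \<cdot>\<^sub>R (D s * D i - D i * D s) - x i \<cdot>\<^sub>C D s" "s \<in> S" "i \<in> I"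
      show ?thesis
        using relation_multiple_IR(2)[OF H(3) SR(1)[OF H(2)]] unfolding Q2[OF H(2,3)] H(1) .
    qed
  next
    fix i j assume H: "i \<in> I" "j \<in> I" "i < j"
    then have "relation g x i j \<in> ?Q1"
      using Q1[OF H(1,2)] by blast
    then show "relation g x i j \<in> ?Q1 \<union> ?Q2"
      by simp
  next
    fix s i assume H: "s \<in> S" "i \<in> I"
    then have "relation g x s i \<in> ?Q2"
      using Q2[OF H] by blast
    then show "relation g x s i \<in> ?Q1 \<union> ?Q2"
      by simp
  qed (use hc hp hm in auto)
  moreover have "h \<noteq> 0"
    using assms by (simp add: h_def mixing_def)
  moreover have "hs s \<noteq> 0" if "s \<in> S" for s
    using hs[OF that assms(2)] coeff_nonzero[OF SR(2)[OF that] range(1)[OF assms(2)]]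
      coeff_nonzero[OF range(1)[OF assms(2)] SR(2)[OF that]] I_neq_R[OF assms(2) SR(1)[OF that]]
    by (cases a s rule: linorder_cases) auto
  moreover have "hc C \<noteq> 0" if "C \<in> T_circ N g x" for C
    using T_nonempty[OF T_circ_T[OF that]] hc[OF that] T_facts(8)[OF T_circ_T[OF that]] assms(2)
    by metis
  moreover have "hp C \<noteq> 0" "hm C \<noteq> 0" if C: "C \<in> T_bullet N g x" for C
  proof -
    \<comment> \<open>Both sides of the component contain elements of \<open>I\<close>, so each of
      the two parameters actually occurs as a nonzero coefficient up to sign.\<close>
    obtain t i j where t: "t \<in> C" "i \<in> I" "j \<in> I" "i < t" "t < j"
      using T_bullet_sides[OF C] .
    then show "hp C \<noteq> 0" "hm C \<noteq> 0"
      using hp[OF C t(1,2,4)] hm[OF C t(1,3,5)] T_facts(8)[OF T_bullet_T[OF C] t(1)] by auto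
  qed
  ultimately show ?thesis
    unfolding type_A_I_def Let_def using assms(1) by blast
qed

lemma is_type_A_II:
  assumes card: "card I \<ge> 3"
    and no_mixing: "\<And>i j. i \<in> I \<Longrightarrow> j \<in> I \<Longrightarrow> i \<noteq> j \<Longrightarrow> \<not> mixing i j"
  shows "type_A_II N g x"
proof -
  obtain h where pot: "diffusion_potential N g x h"
    using potential_exists[OF no_mixing] by blast
  interpret diffusion_potential N g x h
    by (rule pot)
  have less: "g i j \<noteq> 0" "g j i = 0" if "i \<in> I" "j \<in> I" "i < j" for i j
    using coeff_nonzero[OF range(1)[OF that(1)] range(1)[OF that(2)] that(3)] no_mixing[OF that(1,2)] that
    by (auto simp: mixing_def)
  \<comment> \<open>Exactly one of the two coefficients is nonzero, so they cannot cancel.\<close>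
  have skew_I: "skew i j \<noteq> 0" if "i \<in> I" "j \<in> I" "i \<noteq> j" for i j
    using less[of i j] less[of j i] that by (cases i j rule: linorder_cases) (auto simp: skew_def)
  have S: "S = {}"
    by (rule S_empty[OF card skew_I pot])
  obtain hc hp hm where
    hc: "\<And>a t i. \<lbrakk>a \<in> T_circ N g x; t \<in> a; i \<in> I\<rbrakk> \<Longrightarrow> skew i t = h i + hc a" and
    hp: "\<And>b t i. \<lbrakk>b \<in> T_bullet N g x; t \<in> b; i \<in> I; i < t\<rbrakk> \<Longrightarrow> skew i t = h i + hp b" and
    hm: "\<And>b t i. \<lbrakk>b \<in> T_bullet N g x; t \<in> b; i \<in> I; t < i\<rbrakk> \<Longrightarrow> skew i t = h i - hm b"
    using T_parameters by blast
  let ?Q = "{(h i - h j) \<cdot>\<^sub>R (D i * D j) \<doteq> x j \<cdot>\<^sub>C D i - x i \<cdot>\<^sub>C D j | i j.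
            i \<in> I \<and> j \<in> I \<and> i < j}"
  have Q: "relation g x i j = (h i - h j) \<cdot>\<^sub>R (D i * D j) - (x j \<cdot>\<^sub>C D i - x i \<cdot>\<^sub>C D j)"
    if "i \<in> I" "j \<in> I" "i < j" for i j
    using less[OF that] potential[OF that(1,2), symmetric] by (simp add: relation_def skew_def)
  have "same_relations (defining_relations N g x) (?Q
      \<union> {(h i + hc a) \<cdot>\<^sub>R :DD: i t \<doteq> - (x i \<cdot>\<^sub>C D t) | a t i. a \<in> T_circ N g x \<and> t \<in> a \<and> i \<in> I}
      \<union> {(h i + hp b) \<cdot>\<^sub>R (D i * D t) \<doteq> - (x i \<cdot>\<^sub>C D t) | b t i.
          b \<in> T_bullet N g x \<and> t \<in> b \<and> i \<in> I \<and> i < t}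
      \<union> {(hm b - h i) \<cdot>\<^sub>R (D t * D i) \<doteq> x i \<cdot>\<^sub>C D t | b t i.
          b \<in> T_bullet N g x \<and> t \<in> b \<and> i \<in> I \<and> i > t}
      \<union> R_relations N g x)"
  proof (rule same_relations_T)
    fix q assume "q \<in> ?Q"
    then obtain i j where H: "q = (h i - h j) \<cdot>\<^sub>R (D i * D j) - (x j \<cdot>\<^sub>C D i - x i \<cdot>\<^sub>C D j)"
      "i \<in> I" "j \<in> I" "i < j"
      by blast
    show "relation_multiple q"
      using relation_multiple_II[OF H(2,3)] H(4) unfolding Q[OF H(2-4)] H(1) by simp
  next
    fix i j assume H: "i \<in> I" "j \<in> I" "i < j"
    then show "relation g x i j \<in> ?Q"
      using Q[OF H] by blast
  qed (use hc hp hm S in auto)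
  moreover have "h i \<noteq> h j" if "i \<in> I" "j \<in> I" "i \<noteq> j" for i j
    using skew_I[OF that] potential that by simp
  moreover have "h i \<noteq> - hc C" if H: "i \<in> I" "C \<in> T_circ N g x" for i C
  proof -
    obtain t where t: "t \<in> C"
      using T_nonempty[OF T_circ_T[OF H(2)]] .
    show ?thesis
      using hc[OF H(2) t H(1)] T_facts(8)[OF T_circ_T[OF H(2)] t H(1)] by simp
  qed
  moreover have "h i \<noteq> - hp C" if "C \<in> T_bullet N g x" "t \<in> C" "i \<in> I" "i < t" for C t i
    using hp[OF that] T_facts(8)[OF T_bullet_T[OF that(1)] that(2,3)] by simp
  moreover have "h i \<noteq> hm C" if "C \<in> T_bullet N g x" "t \<in> C" "i \<in> I" "i > t" for C t i
    using hm[OF that] T_facts(8)[OF T_bullet_T[OF that(1)] that(2,3)] by simp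
  ultimately show ?thesis
    unfolding type_A_II_def Let_def using card S
    by (intro conjI exI[of _ h] exI[of _ hc] exI[of _ hp] exI[of _ hm]) blast+
qed

section \<open>Exactly two indices in \<open>I\<close>\<close>

lemma is_type_B:
  assumes I: "I = {i, j}" and less: "i < j"
  shows "type_B N g x"
proof -
  have ij: "i \<in> I" "j \<in> I" "i \<noteq> j"
    using assms by auto
  define h where "h = g i j"
  define l where "l = skew i j"
  have l: "g j i = h - l" "skew j i = - l"
    by (simp_all add: h_def l_def skew_def)
  \<comment> \<open>With two indices any antisymmetric function is a difference. This normalisation
    at \<open>i\<close> yields the coefficients \<open>hc a\<close> at \<open>i\<close> and
    \<open>hc a - l\<close> at \<open>j\<close>.\<close>
  have "diffusion_potential N g x (\<lambda>k. if k = i then 0 else - l)"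
    by unfold_locales (use ij I l in \<open>auto simp: l_def skew_def\<close>)
  then interpret diffusion_potential N g x "\<lambda>k. if k = i then 0 else - l" .
  obtain hc hp hm where
    hc: "\<And>a t k. \<lbrakk>a \<in> T_circ N g x; t \<in> a; k \<in> I\<rbrakk> \<Longrightarrow> skew k t = (if k = i then 0 else - l) + hc a" and
    hp: "\<And>b t k. \<lbrakk>b \<in> T_bullet N g x; t \<in> b; k \<in> I; k < t\<rbrakk>
      \<Longrightarrow> skew k t = (if k = i then 0 else - l) + hp b" and
    hm: "\<And>b t k. \<lbrakk>b \<in> T_bullet N g x; t \<in> b; k \<in> I; t < k\<rbrakk>
      \<Longrightarrow> skew k t = (if k = i then 0 else - l) - hm b"
    using T_parameters by blast
  have hci: "skew i t = hc a" "skew j t = hc a - l" if "a \<in> T_circ N g x" "t \<in> a" for a t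
    using hc[OF that ij(1)] hc[OF that ij(2)] ij(3) by simp_all
  have bullet: "i < t" "t < j" if "b \<in> T_bullet N g x" "t \<in> b" for b t
    using that I less by (auto simp: T_bullet_def)
  \<comment> \<open>The value \<open>- l\<close> of the potential at \<open>j\<close> is absorbed
    into the parameter on the right of the component.\<close>
  define hm' where "hm' b = hm b + l" for b
  have hbi: "skew i t = hp b" "skew j t = - hm' b" if "b \<in> T_bullet N g x" "t \<in> b" for b t
    using hp[OF that ij(1) bullet(1)[OF that]] hm[OF that ij(2) bullet(2)[OF that]] ij(3)
    by (simp_all add: hm'_def)
  define hs where "hs s = g i s" for s
  have SR: "s \<in> R" "s \<in> {1..N}" "i \<noteq> s" "j \<noteq> s" if "s \<in> S" for s
    using that S_subset range I_neq_R ij by blast+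
  have hs: "g i s = hs s" "g s j = hs s" "g s i = hs s - l" "g j s = hs s - l" if "s \<in> S" for s
  proof -
    show "g i s = hs s" "g s j = hs s"
      using S_coeff[OF that ij] by (simp_all add: hs_def)
    moreover have "skew i s = l" "g j s = g s i"
      using S_skew[OF that ij] S_coeff[OF that ij(2,1)] ij(3) by (auto simp: l_def)
    ultimately show "g s i = hs s - l" "g j s = hs s - l"
      by (simp_all add: skew_def)
  qed
  let ?Q1 = "{h \<cdot>\<^sub>R (D i * D j) - (h - l) \<cdot>\<^sub>R (D j * D i) \<doteq> x j \<cdot>\<^sub>C D i - x i \<cdot>\<^sub>C D j}"
  let ?Q2 = "{hs s \<cdot>\<^sub>R (D i * D s) - (hs s - l) \<cdot>\<^sub>R (D s * D i) \<doteq> - (x i \<cdot>\<^sub>C D s) | s. s \<in> S}"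
  let ?Q3 = "{hs s \<cdot>\<^sub>R (D s * D j) - (hs s - l) \<cdot>\<^sub>R (D j * D s) \<doteq> x j \<cdot>\<^sub>C D s | s. s \<in> S}"
  let ?Q4 = "{hc a \<cdot>\<^sub>R :DD: i t \<doteq> - (x i \<cdot>\<^sub>C D t) | a t. a \<in> T_circ N g x \<and> t \<in> a}"
  let ?Q5 = "{(hc a - l) \<cdot>\<^sub>R :DD: j t \<doteq> - (x j \<cdot>\<^sub>C D t) | a t. a \<in> T_circ N g x \<and> t \<in> a}"
  let ?Q6 = "{hp b \<cdot>\<^sub>R (D i * D t) \<doteq> - (x i \<cdot>\<^sub>C D t) | b t. b \<in> T_bullet N g x \<and> t \<in> b}"
  let ?Q7 = "{hm' b \<cdot>\<^sub>R (D t * D j) \<doteq> x j \<cdot>\<^sub>C D t | b t. b \<in> T_bullet N g x \<and> t \<in> b}"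
  have Q1: "?Q1 = {relation g x i j}"
    by (simp add: relation_def l flip: h_def)
  have Q2: "?Q2 = {relation g x i s | s. s \<in> S}" and Q3: "?Q3 = {relation g x s j | s. s \<in> S}"
    by (rule Collect_cong, use hs SR relation_IR in metis)+
  have Q4: "?Q4 = {relation g x i t | a t. a \<in> T_circ N g x \<and> t \<in> a}"
    and Q5: "?Q5 = {relation g x j t | a t. a \<in> T_circ N g x \<and> t \<in> a}"
    by (rule Collect_cong, use hci relation_IT(1)[OF T_circ_T] ij in metis)+
  have Q6: "?Q6 = {relation g x i t | b t. b \<in> T_bullet N g x \<and> t \<in> b}"
    by (rule Collect_cong, use hbi relation_IT(2)[OF T_bullet_T] ij bullet in metis)
  have Q7: "?Q7 = {relation g x t j | b t. b \<in> T_bullet N g x \<and> t \<in> b}"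
    by (rule Collect_cong, use hbi relation_IT(3)[OF T_bullet_T] ij bullet in \<open>metis minus_minus\<close>)
  have "t \<in> R" if "C \<in> T" "t \<in> C" for C t
    by (rule T_facts(2)[OF that ij(1)])
  then have mult: "relation_multiple (relation g x k t)" "relation_multiple (relation g x t k)"
    if "k \<in> {i, j}" "t \<in> S \<or> t \<in> C \<and> (C \<in> T_circ N g x \<or> C \<in> T_bullet N g x)" for k t C
    using that relation_multiple_IR SR(1) T_circ_T T_bullet_T I by blast+
  have "same_relations (defining_relations N g x)
      (?Q1 \<union> ?Q2 \<union> ?Q3 \<union> ?Q4 \<union> ?Q5 \<union> ?Q6 \<union> ?Q7 \<union> R_relations N g x)"
    unfolding Q1 Q2 Q3 Q4 Q5 Q6 Q7
  proof (rule same_relations_defining)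
    fix q assume "q \<in> {relation g x i j} \<union> {relation g x i s | s. s \<in> S}
      \<union> {relation g x s j | s. s \<in> S}
      \<union> {relation g x i t | a t. a \<in> T_circ N g x \<and> t \<in> a}
      \<union> {relation g x j t | a t. a \<in> T_circ N g x \<and> t \<in> a}
      \<union> {relation g x i t | b t. b \<in> T_bullet N g x \<and> t \<in> b}
      \<union> {relation g x t j | b t. b \<in> T_bullet N g x \<and> t \<in> b}"
    then show "relation_multiple q"
      using relation_multiple_II[OF ij] mult by (elim UnE) blast+
  next
    fix k m assume "k \<in> I" "m \<in> I" "k < m"
    then have "k = i" "m = j"
      using I less by auto
    then show "relation g x k m \<in> {relation g x i j} \<union> {relation g x i s | s. s \<in> S}
      \<union> {relation g x s j | s. s \<in> S}
      \<union> {relation g x i t | a t. a \<in> T_circ N g x \<and> t \<in> a}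
      \<union> {relation g x j t | a t. a \<in> T_circ N g x \<and> t \<in> a}
      \<union> {relation g x i t | b t. b \<in> T_bullet N g x \<and> t \<in> b}
      \<union> {relation g x t j | b t. b \<in> T_bullet N g x \<and> t \<in> b}"
      by simp
  next
    fix k r assume k: "k \<in> I" and r: "r \<in> R"
    from k I have "k = i \<or> k = j"
      by simp
    with r show "relation g x k r \<in> {relation g x i j} \<union> {relation g x i s | s. s \<in> S}
      \<union> {relation g x s j | s. s \<in> S}
      \<union> {relation g x i t | a t. a \<in> T_circ N g x \<and> t \<in> a}
      \<union> {relation g x j t | a t. a \<in> T_circ N g x \<and> t \<in> a}
      \<union> {relation g x i t | b t. b \<in> T_bullet N g x \<and> t \<in> b}
      \<union> {relation g x t j | b t. b \<in> T_bullet N g x \<and> t \<in> b} \<or>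
      relation g x r k \<in> {relation g x i j} \<union> {relation g x i s | s. s \<in> S}
      \<union> {relation g x s j | s. s \<in> S}
      \<union> {relation g x i t | a t. a \<in> T_circ N g x \<and> t \<in> a}
      \<union> {relation g x j t | a t. a \<in> T_circ N g x \<and> t \<in> a}
      \<union> {relation g x i t | b t. b \<in> T_bullet N g x \<and> t \<in> b}
      \<union> {relation g x t j | b t. b \<in> T_bullet N g x \<and> t \<in> b}"
      by (cases rule: R_cases) blast+
  qed
  moreover have "h \<noteq> 0"
    using coeff_nonzero[OF range(1)[OF ij(1)] range(1)[OF ij(2)] less] by (simp add: h_def)
  moreover have "hs s \<noteq> 0" "s < i \<or> s > j \<Longrightarrow> hs s \<noteq> l" if s: "s \<in> S" for s
  proof -
    note nz = coeff_nonzero[OF range(1)[OF ij(1)] SR(2)[OF s]] coeff_nonzero[OF range(1)[OF ij(2)] SR(2)[OF s]]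
      coeff_nonzero[OF SR(2)[OF s] range(1)[OF ij(1)]] coeff_nonzero[OF SR(2)[OF s] range(1)[OF ij(2)]]
    show "hs s \<noteq> 0"
      \<comment> \<open>For \<open>i < s\<close> the coefficient \<open>g i s\<close> is required to
        be nonzero; for \<open>s < i\<close> also \<open>s < j\<close>, and the equal coefficient
        \<open>g s j\<close> is.\<close>
      using nz hs[OF s] less by (cases "i < s") auto
    show "hs s \<noteq> l" if "s < i \<or> s > j"
      using that nz hs[OF s] by auto
  qed
  moreover have "hc C \<notin> {0, l}" if C: "C \<in> T_circ N g x" for C
  proof -
    obtain t where t: "t \<in> C"
      using T_nonempty[OF T_circ_T[OF C]] .
    show ?thesis
      using hci[OF C t] T_facts(8)[OF T_circ_T[OF C] t] ij by fastforce
  qed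
  moreover have "hp C \<noteq> 0" "hm' C \<noteq> 0" if C: "C \<in> T_bullet N g x" for C
  proof -
    obtain t where t: "t \<in> C"
      using T_nonempty[OF T_bullet_T[OF C]] .
    show "hp C \<noteq> 0" "hm' C \<noteq> 0"
      using hbi[OF C t] T_facts(8)[OF T_bullet_T[OF C] t] ij by fastforce+
  qed
  ultimately show ?thesis
    unfolding type_B_def Let_def using I less
    by (intro exI[of _ i] exI[of _ j] conjI exI[of _ h] exI[of _ l] exI[of _ hs] exI[of _ hc]
        exI[of _ hp] exI[of _ hm'] ballI impI) assumption+
qed

text \<open>The cardinality of \<open>I\<close> decides among the families, except that from three
  elements on the existence of a mixing pair in \<open>I\<close> separates \<open>A_I\<close> from
  \<open>A_II\<close>.\<close>

lemma classification:
  "type_A_I N g x \<or> type_A_II N g x \<or> type_B N g x \<or> type_C N g x \<or> type_D N g x"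
proof -
  have fin: "finite I"
    by (simp add: index_I_def)
  consider "card I = 0" | "card I = 1" | "card I = 2" | "card I \<ge> 3"
    by linarith
  then show ?thesis
  proof cases
    case 1
    with fin is_type_D show ?thesis
      by simp
  next
    case 2
    with is_type_C show ?thesis
      by (auto simp: card_1_singleton_iff)
  next
    case 3
    then obtain a b where "I = {a, b}" "a \<noteq> b"
      by (auto simp: card_2_iff)
    then have "type_B N g x"
      using is_type_B[of a b] is_type_B[of b a] by (cases "a < b") auto
    then show ?thesis
      by blast
  next
    case 4
    with is_type_A_I is_type_A_II show ?thesis
      by blast
  qed
qed

end

theorem theorem3p5:
  fixes N :: nat and g :: "nat \<Rightarrow> nat \<Rightarrow> real" and x :: "nat \<Rightarrow> complex"
  assumes "N \<ge> 1"
    and "diffusion_algebra N g x"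
  shows "type_A_I N g x \<or> type_A_II N g x \<or> type_B N g x \<or> type_C N g x \<or> type_D N g x"
  by (rule diffusion.classification) (unfold_locales, rule assms)

end
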